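(* There exists a countable, acyclic MDP $\mathcal{M}$ with initial state $s_0$, whose step counter is implicit in the state, whose transition probabilities are rational, whose transition rewards are in $\{-1,0,1\}$ and in which every state has at most $2$ successors, such that the value of $s_0$ for $\mathit{TP}_{\liminf\ge 0}=\{\rho\mid \liminf_{n\to\infty}\sum_{j=0}^{n-1} r(e_j)\ge 0\}$ is $1$, while every finite-memory randomized (FR) strategy $\sigma$ satisfies $\mathcal{P}_{\mathcal{M},s_0,\sigma}(\mathit{TP}_{\liminf\ge 0})=0$. In particular, for every $\varepsilon<1$ there are no $\varepsilon$-optimal strategies using a step counter plus finite memory for $\mathit{TP}_{\liminf\ge 0}$ in countable MDPs.
   Context: An MDP has a countable set of states partitioned into controlled and random states, a transition relation (every state has a successor), fixed probability distributions over successors at random states, and real rewards on transitions; runs are $s_0e_0s_1e_1\dots$ with transitions $e_j$. It is acyclic if its transition graph has no directed cycle. The step counter is implicit in the state if for every state $s$ all finite paths from $s_0$ to $s$ have the same length. A strategy assigns to each finite partial run ending in a controlled state a distribution over successors, inducing a probability measure on runs; the value is the supremum of the objective's probability over all strategies; $\varepsilon$-optimal means at least value$-\varepsilon$. FR strategies are those implementable with a finite set of memory modes and (possibly randomized) memory updates and choices depending on the current mode and state. A step counter plus finite memory strategy bases its choices on the current state, the number of steps taken so far, and finitely many memory modes. *)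

theory Defs
  imports "HOL-Probability.Probability"
begin

text \<open>
  Transitions form a relation on states, so a transition is a pair of states, a run
  \<open>s0 e0 s1 e1 \<dots>\<close> is determined by its sequence of states (with \<open>ej = (sj, sj+1)\<close>), and a
  partial run is given by a nonempty list of states. The random states are those states that
  are not controlled. The fields \<open>probs\<close> and \<open>reward\<close> are relevant on random states and on
  transitions only.
\<close>

record 's mdp =
  states :: "'s set"
  controlled :: "'s set"
  transitions :: "('s \<times> 's) set"
  probs :: "'s \<Rightarrow> 's pmf"
  reward :: "'s \<times> 's \<Rightarrow> real"

definition random_states :: "'s mdp \<Rightarrow> 's set" where
  "random_states M = states M - controlled M"

definition successors :: "'s mdp \<Rightarrow> 's \<Rightarrow> 's set" where
  "successors M s = transitions M `` {s}"

definition countable_mdp :: "'s mdp \<Rightarrow> bool" where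
  "countable_mdp M \<longleftrightarrow>
     countable (states M) \<and>
     controlled M \<subseteq> states M \<and>
     transitions M \<subseteq> states M \<times> states M \<and>
     (\<forall>s\<in>states M. successors M s \<noteq> {}) \<and>
     (\<forall>s\<in>random_states M. set_pmf (probs M s) \<subseteq> successors M s)"

definition partial_run :: "'s mdp \<Rightarrow> 's list \<Rightarrow> bool" where
  "partial_run M \<rho> \<longleftrightarrow>
     \<rho> \<noteq> [] \<and> set \<rho> \<subseteq> states M \<and> successively (\<lambda>s s'. (s, s') \<in> transitions M) \<rho>"

definition runs :: "'s mdp \<Rightarrow> (nat \<Rightarrow> 's) set" where
  "runs M = {\<omega>. \<forall>i. (\<omega> i, \<omega> (Suc i)) \<in> transitions M}"

definition step_counter_implicit :: "'s mdp \<Rightarrow> 's \<Rightarrow> bool" where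
  "step_counter_implicit M s0 \<longleftrightarrow>
     (\<forall>s\<in>states M. \<forall>\<rho> \<rho>'.
        partial_run M \<rho> \<and> hd \<rho> = s0 \<and> last \<rho> = s \<and>
        partial_run M \<rho>' \<and> hd \<rho>' = s0 \<and> last \<rho>' = s \<longrightarrow> length \<rho> = length \<rho>')"


section \<open>Strategies and the induced probability measure\<close>

definition strategies :: "'s mdp \<Rightarrow> ('s list \<Rightarrow> 's pmf) set" where
  "strategies M =
     {\<sigma>. \<forall>\<rho>. partial_run M \<rho> \<and> last \<rho> \<in> controlled M \<longrightarrow> set_pmf (\<sigma> \<rho>) \<subseteq> successors M (last \<rho>)}"

definition next_state :: "'s mdp \<Rightarrow> ('s list \<Rightarrow> 's pmf) \<Rightarrow> 's list \<Rightarrow> 's pmf" where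
  "next_state M \<sigma> \<rho> = (if last \<rho> \<in> controlled M then \<sigma> \<rho> else probs M (last \<rho>))"

text \<open>
  The law of the \<open>n\<close>-th state of a run, given the states with index less than \<open>n\<close>.
\<close>

definition run_kernel ::
  "'s mdp \<Rightarrow> 's \<Rightarrow> ('s list \<Rightarrow> 's pmf) \<Rightarrow> nat \<Rightarrow> (nat \<Rightarrow> 's) \<Rightarrow> 's measure" where
  "run_kernel M s0 \<sigma> n \<omega> =
     measure_pmf (if n = 0 then return_pmf s0 else next_state M \<sigma> (map \<omega> [0..<n]))"

text \<open>
  The measure on infinite sequences of states given by the Ionescu-Tulcea extension theorem;
  its values on cylinder sets are computed in \<open>run_measure_cylinder\<close> below. The type of states
  is countable, so that every kernel is measurable for the discrete sigma-algebra.
\<close>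

definition run_measure ::
  "'s::countable mdp \<Rightarrow> 's \<Rightarrow> ('s list \<Rightarrow> 's pmf) \<Rightarrow> (nat \<Rightarrow> 's) measure" where
  "run_measure M s0 \<sigma> =
     projective_family.lim UNIV
       (Ionescu_Tulcea.CI (run_kernel M s0 \<sigma>) (\<lambda>_. count_space UNIV)) (\<lambda>_. count_space UNIV)"

definition value_of :: "'s::countable mdp \<Rightarrow> 's \<Rightarrow> (nat \<Rightarrow> 's) set \<Rightarrow> real" where
  "value_of M s0 Obj = (SUP \<sigma>\<in>strategies M. measure (run_measure M s0 \<sigma>) Obj)"

definition eps_optimal ::
  "'s::countable mdp \<Rightarrow> 's \<Rightarrow> (nat \<Rightarrow> 's) set \<Rightarrow> real \<Rightarrow> ('s list \<Rightarrow> 's pmf) \<Rightarrow> bool" where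
  "eps_optimal M s0 Obj \<epsilon> \<sigma> \<longleftrightarrow>
     \<sigma> \<in> strategies M \<and> measure (run_measure M s0 \<sigma>) Obj \<ge> value_of M s0 Obj - \<epsilon>"

definition TP_liminf_ge_0 :: "'s mdp \<Rightarrow> (nat \<Rightarrow> 's) set" where
  "TP_liminf_ge_0 M =
     {\<omega> \<in> runs M. liminf (\<lambda>n. ereal (\<Sum>j<n. reward M (\<omega> j, \<omega> (Suc j)))) \<ge> 0}"


section \<open>Memory\<close>

text \<open>
  Memory modes are natural numbers; \<open>B\<close> is the set of modes in use. In step \<open>n\<close>, mode \<open>m\<close> and
  state \<open>s\<close>, the distribution \<open>\<tau> n (m, s)\<close> yields the next mode together with the next state.
  At random states the next state must be distributed as in the MDP. The argument \<open>n\<close> is the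
  step counter.
\<close>

definition memory_update ::
  "'s mdp \<Rightarrow> nat set \<Rightarrow> (nat \<Rightarrow> nat \<times> 's \<Rightarrow> (nat \<times> 's) pmf) \<Rightarrow> bool" where
  "memory_update M B \<tau> \<longleftrightarrow>
     (\<forall>n. \<forall>m\<in>B.
        (\<forall>s\<in>controlled M. set_pmf (\<tau> n (m, s)) \<subseteq> B \<times> successors M s) \<and>
        (\<forall>s\<in>random_states M. fst ` set_pmf (\<tau> n (m, s)) \<subseteq> B \<and>
                               map_pmf snd (\<tau> n (m, s)) = probs M s))"

text \<open>
  \<open>mode_weight B m0 \<tau> \<rho> k m\<close> is the probability that the Markov chain on modes and states
  that is given by \<open>\<tau>\<close>, started in \<open>(m0, \<rho> ! 0)\<close>, visits the states \<open>\<rho> ! 0, \<dots>, \<rho> ! k\<close> and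
  then is in mode \<open>m\<close>.
\<close>

primrec mode_weight ::
  "nat set \<Rightarrow> nat \<Rightarrow> (nat \<Rightarrow> nat \<times> 's \<Rightarrow> (nat \<times> 's) pmf) \<Rightarrow> 's list \<Rightarrow> nat \<Rightarrow> nat \<Rightarrow> real" where
  "mode_weight B m0 \<tau> \<rho> 0 m = (if m = m0 then 1 else 0)"
| "mode_weight B m0 \<tau> \<rho> (Suc k) m =
     (\<Sum>m'\<in>B. mode_weight B m0 \<tau> \<rho> k m' * pmf (\<tau> k (m', \<rho> ! k)) (m, \<rho> ! Suc k))"

text \<open>
  The strategy induced by \<open>(m0, \<tau>)\<close> averages the choices of \<open>\<tau>\<close> over the conditional
  distribution of the current mode given the observed partial run. Nothing is required on
  partial runs that have probability \<open>0\<close> in the chain, where this conditional distribution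
  does not exist.
\<close>

definition induced_by ::
  "'s mdp \<Rightarrow> nat set \<Rightarrow> nat \<Rightarrow> (nat \<Rightarrow> nat \<times> 's \<Rightarrow> (nat \<times> 's) pmf) \<Rightarrow> ('s list \<Rightarrow> 's pmf) \<Rightarrow> bool"
  where
  "induced_by M B m0 \<tau> \<sigma> \<longleftrightarrow>
     (\<forall>\<rho>. partial_run M \<rho> \<and> last \<rho> \<in> controlled M \<longrightarrow>
        (let k = length \<rho> - 1; Z = (\<Sum>m\<in>B. mode_weight B m0 \<tau> \<rho> k m) in
           Z > 0 \<longrightarrow>
             (\<forall>s'. pmf (\<sigma> \<rho>) s' =
                (\<Sum>m\<in>B. mode_weight B m0 \<tau> \<rho> k m / Z * pmf (map_pmf snd (\<tau> k (m, last \<rho>))) s'))))"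

definition FR_strategies :: "'s mdp \<Rightarrow> ('s list \<Rightarrow> 's pmf) set" where
  "FR_strategies M =
     {\<sigma> \<in> strategies M. \<exists>B m0 \<tau>. finite B \<and> m0 \<in> B \<and>
        memory_update M B (\<lambda>_. \<tau>) \<and> induced_by M B m0 (\<lambda>_. \<tau>) \<sigma>}"

definition step_counter_finite_memory_strategies :: "'s mdp \<Rightarrow> ('s list \<Rightarrow> 's pmf) set" where
  "step_counter_finite_memory_strategies M =
     {\<sigma> \<in> strategies M. \<exists>B m0 \<tau>. finite B \<and> m0 \<in> B \<and>
        memory_update M B \<tau> \<and> induced_by M B m0 \<tau> \<sigma>}"


section \<open>Well-definedness\<close>

lemma strategies_nonempty:
  assumes "countable_mdp M"
  shows "strategies M \<noteq> {}"
proof -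
  have "(\<lambda>\<rho>. return_pmf (SOME s. s \<in> successors M (last \<rho>))) \<in> strategies M"
    using assms
    by (auto simp: strategies_def countable_mdp_def subset_iff some_in_eq)
  then show ?thesis
    by blast
qed

lemma measurable_discrete_PiM:
  fixes f :: "(nat \<Rightarrow> 's::countable) \<Rightarrow> 'b"
  assumes "\<And>x. f x \<in> space N"
  shows "f \<in> measurable (PiM {0..<n} (\<lambda>_. count_space UNIV)) N"
proof -
  have "sets (PiM {0..<n} (\<lambda>_. count_space (UNIV :: 's set)))
      = sets (count_space ({0..<n} \<rightarrow>\<^sub>E (UNIV :: 's set)))"
    by (rule count_space_PiM_finite [THEN arg_cong]) auto
  then show ?thesis
    using assms by (auto simp: measurable_def space_PiM)
qed

lemma Ionescu_Tulcea_run_kernel: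
  "Ionescu_Tulcea (run_kernel M s0 \<sigma>) (\<lambda>_. count_space (UNIV :: 's::countable set))"
proof (rule Ionescu_Tulcea.intro)
  fix i
  show "run_kernel M s0 \<sigma> i \<in> measurable (PiM {0..<i} (\<lambda>_. count_space UNIV))
      (subprob_algebra (count_space UNIV))"
    by (rule measurable_discrete_PiM)
       (auto simp: run_kernel_def space_subprob_algebra measure_pmf.subprob_space_axioms)
  show "prob_space (run_kernel M s0 \<sigma> i x)" for x
    by (auto simp: run_kernel_def measure_pmf.prob_space_axioms)
qed

lemma space_run_measure [simp]: "space (run_measure M s0 \<sigma>) = UNIV"
  and sets_run_measure [measurable_cong]:
    "sets (run_measure M s0 \<sigma>) = sets (PiM UNIV (\<lambda>_. count_space UNIV))"
proof -
  interpret Ionescu_Tulcea "run_kernel M s0 \<sigma>" "\<lambda>_. count_space UNIV"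
    by (rule Ionescu_Tulcea_run_kernel)
  show "space (run_measure M s0 \<sigma>) = UNIV"
    by (simp add: run_measure_def space_PiM)
  show "sets (run_measure M s0 \<sigma>) = sets (PiM UNIV (\<lambda>_. count_space UNIV))"
    by (simp add: run_measure_def)
qed

lemma emeasure_run_measure_cylinder:
  "emeasure (run_measure M s0 \<sigma>) {\<omega>. \<forall>i<n. \<omega> i = x i}
   = (\<Prod>i<n. emeasure (run_kernel M s0 \<sigma> i x) {x i})"
proof -
  let ?M = "\<lambda>_::nat. count_space (UNIV :: 'a set)"
  interpret Ionescu_Tulcea "run_kernel M s0 \<sigma>" ?M
    by (rule Ionescu_Tulcea_run_kernel)
  have sing: "{restrict x {0..<n}} \<in> sets (PiM {0..<n} ?M)" for n
    by (subst PiE_singleton [symmetric, OF restrict_extensional]) (auto intro!: sets_PiM_I_finite)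
  have u: "(\<lambda>_. undefined) \<in> space (PiM {0..<0::nat} ?M)"
    by (simp add: space_PiM)
  have C: "emeasure (C 0 n (\<lambda>_. undefined)) {restrict x {0..<n}}
      = (\<Prod>i<n. emeasure (run_kernel M s0 \<sigma> i x) {x i})" for n
  proof (induction n)
    case 0
    show ?case
      using sing [of 0] by (simp add: emeasure_return restrict_def)
  next
    case (Suc n)
    have sp: "space (C 0 n (\<lambda>_. undefined)) = space (PiM {0..<n} ?M)"
      using space_C [OF u] by simp
    have "emeasure (C 0 (Suc n) (\<lambda>_. undefined)) {restrict x {0..<Suc n}}
        = (\<integral>\<^sup>+\<omega>. emeasure (eP n \<omega>) {restrict x {0..<Suc n}} \<partial>C 0 n (\<lambda>_. undefined))"
      unfolding C.simps add_0
    proof (rule emeasure_bind)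
      show "space (C 0 n (\<lambda>_. undefined)) \<noteq> {}"
        by (simp add: sp space_PiM PiE_eq_empty_iff)
      show "eP n \<in> C 0 n (\<lambda>_. undefined) \<rightarrow>\<^sub>M subprob_algebra (PiM {0..<Suc n} ?M)"
        using measurable_eP [of n] sets_C [OF u, of n]
        by (simp cong: measurable_cong_sets)
    qed (rule sing)
    also have "\<dots> = (\<integral>\<^sup>+\<omega>. emeasure (run_kernel M s0 \<sigma> n x) {x n} *
        indicator {restrict x {0..<n}} \<omega> \<partial>C 0 n (\<lambda>_. undefined))"
    proof (rule nn_integral_cong)
      fix \<omega> assume "\<omega> \<in> space (C 0 n (\<lambda>_. undefined))"
      then have w: "\<omega> \<in> space (PiM {0..<n} ?M)"
        by (simp add: sp)
      have ext: "\<omega> i = undefined" if "\<not> i < n" for i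
        using w that by (auto simp: space_PiM PiE_def extensional_def)
      have eq: "fun_upd \<omega> n y = restrict x {0..<Suc n} \<longleftrightarrow> \<omega> = restrict x {0..<n} \<and> y = x n" for y
        using ext by (auto simp: fun_eq_iff restrict_def less_Suc_eq)
      have "map (restrict x {0..<n}) [0..<n] = map x [0..<n]"
        by simp
      then have "run_kernel M s0 \<sigma> n (restrict x {0..<n}) = run_kernel M s0 \<sigma> n x"
        unfolding run_kernel_def by metis
      then show "emeasure (eP n \<omega>) {restrict x {0..<Suc n}}
          = emeasure (run_kernel M s0 \<sigma> n x) {x n} * indicator {restrict x {0..<n}} \<omega>"
        by (auto simp: emeasure_eP [OF w sing] vimage_def eq split: split_indicator)
    qed
    also have "\<dots> = emeasure (run_kernel M s0 \<sigma> n x) {x n} * 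
        emeasure (C 0 n (\<lambda>_. undefined)) {restrict x {0..<n}}"
      using sing [of n] sets_C [OF u, of n] by (simp add: nn_integral_cmult_indicator)
    finally show ?case
      by (simp only: Suc.IH prod.lessThan_Suc mult.commute)
  qed
  have "{\<omega>. \<forall>i<n. \<omega> i = x i} = PF.emb UNIV {0..<n} {restrict x {0..<n}}"
    by (auto simp: prod_emb_def space_PiM fun_eq_iff restrict_def split: if_splits)
  then have "emeasure (run_measure M s0 \<sigma>) {\<omega>. \<forall>i<n. \<omega> i = x i}
      = emeasure (CI {0..<n}) {restrict x {0..<n}}"
    by (simp add: run_measure_def lim sing)
  also have "\<dots> = emeasure (C 0 n (\<lambda>_. undefined)) (PF.emb {0..<n} {0..<n} {restrict x {0..<n}})"
    by (rule emeasure_CI) (auto simp: sing)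
  also have "PF.emb {0..<n} {0..<n} {restrict x {0..<n}} = {restrict x {0..<n}}"
    using sets.sets_into_space [OF sing] by (simp add: prod_emb_id space_PiM)
  finally show ?thesis
    by (simp add: C)
qed

lemma prob_space_run_measure: "prob_space (run_measure M s0 \<sigma>)"
  using emeasure_run_measure_cylinder [of M s0 \<sigma> 0] by (auto intro: prob_spaceI)

lemma run_measure_cylinder:
  "measure (run_measure M s0 \<sigma>) {\<omega>. \<forall>i\<le>n. \<omega> i = x i}
   = (if x 0 = s0 then 1 else 0) *
     (\<Prod>i<n. pmf (next_state M \<sigma> (map x [0..<Suc i])) (x (Suc i)))"
proof -
  have "emeasure (run_measure M s0 \<sigma>) {\<omega>. \<forall>i\<le>n. \<omega> i = x i}
      = (\<Prod>i<Suc n. emeasure (run_kernel M s0 \<sigma> i x) {x i})"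
    using emeasure_run_measure_cylinder [of M s0 \<sigma> "Suc n" x] by (simp add: less_Suc_eq_le)
  also have "\<dots> = (\<Prod>i<Suc n. ennreal (measure (run_kernel M s0 \<sigma> i x) {x i}))"
    by (simp add: run_kernel_def measure_pmf.emeasure_eq_measure)
  finally have "measure (run_measure M s0 \<sigma>) {\<omega>. \<forall>i\<le>n. \<omega> i = x i}
      = (\<Prod>i<Suc n. measure (run_kernel M s0 \<sigma> i x) {x i})"
    by (simp add: measure_def prod_ennreal prod_nonneg del: prod.lessThan_Suc)
  also have "\<dots> = measure (run_kernel M s0 \<sigma> 0 x) {x 0} *
      (\<Prod>i<n. measure (run_kernel M s0 \<sigma> (Suc i) x) {x (Suc i)})"
    by (rule prod.lessThan_Suc_shift)
  finally show ?thesis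
    by (auto simp: run_kernel_def pmf.rep_eq simp del: upt_Suc)
qed

lemma sets_TP_liminf_ge_0: "TP_liminf_ge_0 M \<in> sets (run_measure N s0 \<sigma>)"
proof -
  let ?P = "PiM UNIV (\<lambda>_::nat. count_space (UNIV :: 'a set))"
  have pair: "(\<lambda>\<omega>. f (\<omega> i) (\<omega> (Suc i))) \<in> measurable ?P (count_space UNIV)"
    for f :: "'a \<Rightarrow> 'a \<Rightarrow> 'b" and i
    by (rule measurable_compose_countable [where g = "\<lambda>\<omega>. \<omega> i"])
       (auto intro: measurable_compose [OF measurable_component_singleton])
  have [measurable]: "(\<lambda>\<omega>. reward M (\<omega> i, \<omega> (Suc i))) \<in> borel_measurable ?P" for i
    using measurable_compose [OF pair [of "\<lambda>s s'. reward M (s, s')" i], of "\<lambda>r. r" borel] by simp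
  have [measurable]: "Measurable.pred ?P (\<lambda>\<omega>. (\<omega> i, \<omega> (Suc i)) \<in> transitions M)" for i
    by (rule pair)
  have "{\<omega> \<in> space ?P. (\<forall>i. (\<omega> i, \<omega> (Suc i)) \<in> transitions M) \<and>
      0 \<le> liminf (\<lambda>n. ereal (\<Sum>j<n. reward M (\<omega> j, \<omega> (Suc j))))} \<in> sets ?P"
    by measurable
  then show ?thesis
    by (simp add: TP_liminf_ge_0_def runs_def sets_run_measure space_PiM)
qed

end

theory Submission
  imports Defs
begin

text \<open>
  The MDP runs through infinitely many gadgets. In a gadget of level \<open>K\<close>, with \<open>r = 2^-K\<close>, nature
  stops a counter at some \<open>i \<le> K\<close>, where the conditional probability of stopping at \<open>i < K\<close> is
  \<open>r^(K-i)\<close>, and pays \<open>i * m\<close> for some \<open>m\<close> that exceeds all that can have been earned before. The state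
  then forgets \<open>i\<close>, the player stops a counter at some \<open>j \<le> K\<close> and pays back \<open>j * m\<close>, but is first
  lost forever with probability \<open>r^(j+1)\<close> if \<open>j < K\<close>. Choosing \<open>j > i\<close> makes the total payoff
  negative, hence may happen only finitely often; choosing \<open>j = i\<close> costs a risk of at most
  \<open>K * r^(K+1)\<close>. If the number of memory modes is at most \<open>K\<close>, then two values \<open>i < i'\<close> of
  nature's counter lead with substantial probability to the same mode. In that mode, \<open>j > i\<close> is a
  mistake in the first case and \<open>j \<le> i\<close> is too risky in the second, so a mistake or a loss has
  probability of order \<open>r^K\<close>. With \<open>2^(K^2)\<close> gadgets of level \<open>K\<close>, the sum of \<open>K * r^(K+1)\<close> over all
  gadgets is finite and that of \<open>r^K\<close> is infinite.

  To reach value one, the player takes no risk up to a late gadget (\<open>j = K\<close>), balances all deficits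
  there by \<open>j = i - 1\<close>, and plays \<open>j = i\<close> afterwards.
\<close>


section \<open>Iterated kernels and the law of finite histories\<close>

text \<open>The exponents of \<open>r\<close> are balanced so that answering \<open>i\<close> by
  \<open>j = i\<close> costs \<open>r^(K-i) * r^(i+1) = r^(K+1)\<close>, whatever \<open>i\<close>
  is. If a mode is shared by \<open>i < i'\<close>, then an answer \<open>j \<le> i\<close> costs at
  least \<open>r^(K-i') * r^(i+1) \<ge> r^K\<close> in the case of \<open>i'\<close>. Ignorance thus
  costs a factor \<open>1/r\<close>, and this factor is all that separates the two series: level
  \<open>K\<close> contributes \<open>2^(K^2) * r^K = 1\<close> to the divergent one and
  \<open>K * 2^-K\<close> to the convergent one. With a constant \<open>r\<close> the first series
  could not converge while the second diverges, so \<open>r\<close> has to shrink with the level.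
  Bounded rewards force a large payment to be made in many unit steps; idle steps give every half a
  fixed length, so that the time does not betray \<open>i\<close>. As the time is part of the state,
  a step counter tells a strategy nothing new, and both kinds of finite memory are treated at once,
  by a Markov chain on pairs of mode and state. Updates of the mode are arbitrary and may be
  correlated with nature's moves, which is why the bounds for this chain are made uniform in the
  mode.\<close>

primrec iter_pmf :: "('a \<Rightarrow> 'a pmf) \<Rightarrow> nat \<Rightarrow> 'a \<Rightarrow> 'a pmf" where
  "iter_pmf \<kappa> 0 x = return_pmf x"
| "iter_pmf \<kappa> (Suc k) x = bind_pmf (iter_pmf \<kappa> k x) \<kappa>"

lemma iter_pmf_add: "iter_pmf \<kappa> (a + b) x = bind_pmf (iter_pmf \<kappa> a x) (iter_pmf \<kappa> b)"
  by (induction b) (simp_all add: bind_return_pmf' bind_assoc_pmf)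

lemma iter_pmf_invariant:
  assumes "y \<in> set_pmf (iter_pmf \<kappa> k x)" "P x" "\<And>x y. P x \<Longrightarrow> y \<in> set_pmf (\<kappa> x) \<Longrightarrow> P y"
  shows "P y"
  using assms(1) by (induction k arbitrary: y) (auto intro: assms(2,3))

text \<open>Lumpability of a Markov chain: on the invariant set \<open>P\<close> the kernel acts on
  the fibres of \<open>f\<close> through \<open>\<kappa>'\<close>, so the image process is again a
  chain. It serves to pass from pairs of mode and history to pairs of mode and current
  state.\<close>

lemma iter_pmf_lump:
  assumes "P x" "\<And>x y. P x \<Longrightarrow> y \<in> set_pmf (\<kappa> x) \<Longrightarrow> P y"
    and "\<And>x. P x \<Longrightarrow> map_pmf f (\<kappa> x) = \<kappa>' (f x)"
  shows "map_pmf f (iter_pmf \<kappa> k x) = iter_pmf \<kappa>' k (f x)"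
proof (induction k)
  case (Suc k)
  have "map_pmf f (iter_pmf \<kappa> (Suc k) x) = bind_pmf (iter_pmf \<kappa> k x) (\<lambda>y. map_pmf f (\<kappa> y))"
    by (simp add: map_bind_pmf)
  also have "\<dots> = bind_pmf (iter_pmf \<kappa> k x) (\<lambda>y. \<kappa>' (f y))"
    by (rule bind_pmf_cong) (auto intro!: assms(3) elim: iter_pmf_invariant[where P = P, OF _ assms(1,2)])
  also have "\<dots> = bind_pmf (map_pmf f (iter_pmf \<kappa> k x)) \<kappa>'"
    by (simp add: bind_map_pmf)
  finally show ?case by (simp add: Suc)
qed simp

lemma prob_bind_pmf:
  "measure_pmf.prob (bind_pmf X f) A = (\<integral>y. measure_pmf.prob (f y) A \<partial>measure_pmf X)"
proof -
  have "ennreal (measure_pmf.prob (bind_pmf X f) A) = (\<integral>\<^sup>+y. ennreal (measure_pmf.prob (f y) A) \<partial>measure_pmf X)"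
    by (simp add: measure_pmf.emeasure_eq_measure[symmetric])
  also have "\<dots> = ennreal (\<integral>y. measure_pmf.prob (f y) A \<partial>measure_pmf X)"
    by (rule nn_integral_eq_integral) (auto intro!: measure_pmf.integrable_const_bound[where B = 1])
  finally show ?thesis
    by (simp add: ennreal_inj integral_nonneg_AE)
qed

definition extend_history :: "'s mdp \<Rightarrow> ('s list \<Rightarrow> 's pmf) \<Rightarrow> 's list \<Rightarrow> 's list pmf" where
  "extend_history M \<sigma> \<rho> = map_pmf (\<lambda>s. \<rho> @ [s]) (next_state M \<sigma> \<rho>)"

definition history :: "'s mdp \<Rightarrow> 's \<Rightarrow> ('s list \<Rightarrow> 's pmf) \<Rightarrow> nat \<Rightarrow> 's list pmf" where
  "history M s0 \<sigma> k = iter_pmf (extend_history M \<sigma>) k [s0]"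

lemma history_0 [simp]: "history M s0 \<sigma> 0 = return_pmf [s0]"
  and history_Suc: "history M s0 \<sigma> (Suc k) = bind_pmf (history M s0 \<sigma> k) (extend_history M \<sigma>)"
  by (simp_all add: history_def)

lemma length_history: "\<rho> \<in> set_pmf (history M s0 \<sigma> k) \<Longrightarrow> length \<rho> = Suc k"
  by (induction k arbitrary: \<rho>) (auto simp: history_Suc extend_history_def)

lemma nth_0_history: "\<rho> \<in> set_pmf (history M s0 \<sigma> k) \<Longrightarrow> \<rho> ! 0 = s0"
proof (induction k arbitrary: \<rho>)
  case (Suc k)
  then show ?case
    using length_history[of _ M s0 \<sigma> k] by (force simp: history_Suc extend_history_def nth_append)
qed simp

lemma partial_run_history:
  assumes "countable_mdp M" "s0 \<in> states M" "\<sigma> \<in> strategies M"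
  shows "\<rho> \<in> set_pmf (history M s0 \<sigma> k) \<Longrightarrow> partial_run M \<rho>"
proof (induction k arbitrary: \<rho>)
  case 0
  then show ?case using assms by (simp add: partial_run_def)
next
  case (Suc k)
  then obtain \<rho>' s where \<rho>': "\<rho>' \<in> set_pmf (history M s0 \<sigma> k)" "\<rho> = \<rho>' @ [s]"
    "s \<in> set_pmf (next_state M \<sigma> \<rho>')"
    by (auto simp: history_Suc extend_history_def)
  have pr: "partial_run M \<rho>'"
    using Suc.IH \<rho>' by blast
  then have "last \<rho>' \<in> states M"
    by (auto simp: partial_run_def)
  then have "s \<in> successors M (last \<rho>')"
    using \<rho>'(3) pr assms
    by (auto simp: next_state_def strategies_def countable_mdp_def random_states_def split: if_splits)
  then show ?case
    using pr assms unfolding \<rho>'(2)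
    by (auto simp: partial_run_def successors_def successively_append_iff countable_mdp_def)
qed

text \<open>A history determines the history one step earlier, so a single predecessor contributes
  to its mass.\<close>

lemma pmf_bind_snoc:
  assumes "\<And>y. y \<in> set_pmf X \<Longrightarrow> pmf (f y) z = (if y = x then c else 0)"
  shows "pmf (bind_pmf X f) z = pmf X x * c"
proof -
  have "pmf (bind_pmf X f) z = (\<integral>y. c * indicator {x} y \<partial>measure_pmf X)"
    unfolding pmf_bind by (rule integral_cong_AE) (auto simp: AE_measure_pmf_iff assms)
  then show ?thesis
    by (simp add: pmf.rep_eq)
qed

lemma pmf_extend_history: "pmf (extend_history M \<sigma> \<rho>') (\<rho> @ [s]) = (if \<rho>' = \<rho> then pmf (next_state M \<sigma> \<rho>) s else 0)"
proof (cases "\<rho>' = \<rho>")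
  case True
  then show ?thesis
    using pmf_map_inj'[of "\<lambda>s. \<rho> @ [s]"] by (simp add: extend_history_def inj_def)
next
  case False
  then have "\<rho> @ [s] \<notin> set_pmf (extend_history M \<sigma> \<rho>')"
    by (auto simp: extend_history_def)
  then show ?thesis
    using False by (simp add: set_pmf_iff)
qed

lemma pmf_history_snoc:
  "pmf (history M s0 \<sigma> (Suc k)) (\<rho> @ [s]) = pmf (history M s0 \<sigma> k) \<rho> * pmf (next_state M \<sigma> \<rho>) s"
  unfolding history_Suc by (rule pmf_bind_snoc) (simp add: pmf_extend_history)

lemma pmf_history:
  "pmf (history M s0 \<sigma> k) (map x [0..<Suc k]) =
     (if x 0 = s0 then 1 else 0) *
     (\<Prod>i<k. pmf (next_state M \<sigma> (map x [0..<Suc i])) (x (Suc i)))"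
proof (induction k)
  case (Suc k)
  have "map x [0..<Suc (Suc k)] = map x [0..<Suc k] @ [x (Suc k)]"
    by simp
  then show ?case
    by (simp only: pmf_history_snoc Suc) simp
qed (auto simp: pmf_return)

section \<open>Events that depend on finitely many coordinates\<close>

lemma sets_prefix:
  fixes M :: "'s::countable mdp"
  shows "{\<omega>. P (map \<omega> [0..<k])} \<in> sets (run_measure M s0 \<sigma>)"
proof -
  let ?P = "PiM UNIV (\<lambda>_::nat. count_space (UNIV :: 's set))"
  have *: "{\<omega>. map \<omega> [0..<k] = \<rho>} \<in> sets ?P" for \<rho> :: "'s list"
  proof -
    have "{\<omega>. map \<omega> [0..<k] = \<rho>} = {\<omega>\<in>space ?P. length \<rho> = k \<and> (\<forall>i<k. \<omega> i = \<rho> ! i)}"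
      by (auto simp: space_PiM list_eq_iff_nth_eq)
    also have "\<dots> \<in> sets ?P"
      by measurable
    finally show ?thesis .
  qed
  have "{\<omega>. P (map \<omega> [0..<k])} = (\<Union>\<rho>\<in>{\<rho>. P \<rho>}. {\<omega>. map \<omega> [0..<k] = \<rho>})"
    by auto
  also have "\<dots> \<in> sets ?P"
    by (rule sets.countable_UN') (use * in auto)
  finally show ?thesis
    by (simp add: sets_run_measure)
qed

text \<open>The bridge from the Ionescu-Tulcea measure to the discrete laws \<open>history\<close>:
  prefix events can be computed in a \<open>pmf\<close>.\<close>

lemma run_measure_prefix:
  fixes M :: "'s::countable mdp"
  shows "measure (run_measure M s0 \<sigma>) {\<omega>. P (map \<omega> [0..<Suc k])} =
    measure_pmf.prob (history M s0 \<sigma> k) {\<rho>. P \<rho>}"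
proof -
  let ?R = "run_measure M s0 \<sigma>" and ?f = "\<lambda>\<omega>::nat \<Rightarrow> 's. map \<omega> [0..<Suc k]"
  have f: "?f \<in> measurable ?R (count_space UNIV)"
  proof (rule measurableI)
    fix A :: "'s list set"
    have "?f -` A \<inter> space ?R = {\<omega>. ?f \<omega> \<in> A}"
      by (simp add: vimage_def del: upt_Suc)
    then show "?f -` A \<inter> space ?R \<in> sets ?R"
      using sets_prefix[of "\<lambda>\<rho>. \<rho> \<in> A" "Suc k" M s0 \<sigma>] by (simp del: upt_Suc)
  qed simp
  have "distr ?R (count_space UNIV) ?f = measure_pmf (history M s0 \<sigma> k)"
  proof (rule measure_eqI_countable)
    fix \<rho> :: "'s list"
    interpret prob_space ?R by (rule prob_space_run_measure)
    have d: "emeasure (distr ?R (count_space UNIV) ?f) {\<rho>} = measure ?R {\<omega>. ?f \<omega> = \<rho>}"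
      using f by (simp add: emeasure_distr vimage_def emeasure_eq_measure del: upt_Suc)
    show "emeasure (distr ?R (count_space UNIV) ?f) {\<rho>} = emeasure (measure_pmf (history M s0 \<sigma> k)) {\<rho>}"
    proof (cases "length \<rho> = Suc k")
      case True
      have eq: "{\<omega>. ?f \<omega> = \<rho>} = {\<omega>. \<forall>i\<le>k. \<omega> i = \<rho> ! i}"
        using True by (auto simp: list_eq_iff_nth_eq less_Suc_eq_le simp del: upt_Suc)
      have \<rho>: "map ((!) \<rho>) [0..<Suc k] = \<rho>"
        using map_nth[of \<rho>] True by simp
      show ?thesis
        unfolding d eq run_measure_cylinder
        using pmf_history[of M s0 \<sigma> k "(!) \<rho>"] by (simp add: \<rho> emeasure_pmf_single del: upt_Suc)
    next
      case False
      then have "{\<omega>. ?f \<omega> = \<rho>} = {}"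
        by (auto simp del: upt_Suc)
      moreover have "pmf (history M s0 \<sigma> k) \<rho> = 0"
        using False length_history[of \<rho> M s0 \<sigma> k] by (auto simp: pmf_eq_0_set_pmf)
      ultimately show ?thesis
        unfolding d by (simp add: emeasure_pmf_single)
    qed
  qed (auto simp: )
  then have "measure (distr ?R (count_space UNIV) ?f) {\<rho>. P \<rho>} = measure_pmf.prob (history M s0 \<sigma> k) {\<rho>. P \<rho>}"
    by simp
  then show ?thesis
    using f by (simp add: measure_distr vimage_def del: upt_Suc)
qed

lemma AE_prefix:
  fixes M :: "'s::countable mdp"
  assumes "\<And>\<rho>. \<rho> \<in> set_pmf (history M s0 \<sigma> k) \<Longrightarrow> P \<rho>"
  shows "AE \<omega> in run_measure M s0 \<sigma>. P (map \<omega> [0..<Suc k])"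
proof -
  interpret prob_space "run_measure M s0 \<sigma>" by (rule prob_space_run_measure)
  have "prob {\<omega>. P (map \<omega> [0..<Suc k])} = 1"
    unfolding run_measure_prefix
    by (simp add: measure_pmf.prob_eq_1 AE_measure_pmf_iff assms)
  then have "AE \<omega> in run_measure M s0 \<sigma>. \<omega> \<in> {\<omega>. P (map \<omega> [0..<Suc k])}"
    by (subst prob_eq_1[symmetric]) (simp_all only: sets_prefix)
  then show ?thesis by simp
qed

lemma AE_next_state:
  fixes M :: "'s::countable mdp"
  shows "AE \<omega> in run_measure M s0 \<sigma>. \<forall>t. \<omega> (Suc t) \<in> set_pmf (next_state M \<sigma> (map \<omega> [0..<Suc t]))"
proof (subst AE_all_countable, rule allI)
  fix t
  have "AE \<omega> in run_measure M s0 \<sigma>. (\<lambda>\<rho>. last \<rho> \<in> set_pmf (next_state M \<sigma> (butlast \<rho>))) (map \<omega> [0..<Suc (Suc t)])"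
    by (rule AE_prefix) (auto simp: history_Suc extend_history_def)
  then show "AE \<omega> in run_measure M s0 \<sigma>. \<omega> (Suc t) \<in> set_pmf (next_state M \<sigma> (map \<omega> [0..<Suc t]))"
    by (simp add: butlast_append)
qed

lemma AE_start:
  fixes M :: "'s::countable mdp"
  shows "AE \<omega> in run_measure M s0 \<sigma>. \<omega> 0 = s0"
  using AE_prefix[of M s0 \<sigma> 0 "\<lambda>\<rho>. \<rho> ! 0 = s0"] by simp

text \<open>Conditioning on the first \<open>Suc t\<close> states, a bound for the next step that is
  uniform on \<open>A\<close> multiplies the probability of \<open>A\<close>. This is how single
  moves of nature are charged.\<close>

lemma run_measure_step_le:
  fixes M :: "'s::countable mdp"
  assumes "\<And>\<rho>. length \<rho> = Suc t \<Longrightarrow> A \<rho> \<Longrightarrow> measure_pmf.prob (next_state M \<sigma> \<rho>) S \<le> p" "0 \<le> p"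
  shows "measure (run_measure M s0 \<sigma>) {\<omega>. A (map \<omega> [0..<Suc t]) \<and> \<omega> (Suc t) \<in> S} \<le>
    p * measure (run_measure M s0 \<sigma>) {\<omega>. A (map \<omega> [0..<Suc t])}"
proof -
  let ?H = "history M s0 \<sigma> t"
  have "measure (run_measure M s0 \<sigma>) {\<omega>. A (map \<omega> [0..<Suc t]) \<and> \<omega> (Suc t) \<in> S} =
    measure (run_measure M s0 \<sigma>) {\<omega>. (\<lambda>\<rho>. A (butlast \<rho>) \<and> last \<rho> \<in> S) (map \<omega> [0..<Suc (Suc t)])}"
    by (simp add: butlast_append)
  also have "\<dots> = measure_pmf.prob (history M s0 \<sigma> (Suc t)) {\<rho>. A (butlast \<rho>) \<and> last \<rho> \<in> S}"
    by (rule run_measure_prefix)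
  also have "\<dots> = (\<integral>\<rho>. measure_pmf.prob (extend_history M \<sigma> \<rho>) {\<rho>. A (butlast \<rho>) \<and> last \<rho> \<in> S} \<partial>measure_pmf ?H)"
    by (simp add: history_Suc prob_bind_pmf)
  also have "\<dots> \<le> (\<integral>\<rho>. p * indicator {\<rho>. A \<rho>} \<rho> \<partial>measure_pmf ?H)"
  proof (rule integral_mono_AE)
    show "AE \<rho> in measure_pmf ?H. measure_pmf.prob (extend_history M \<sigma> \<rho>) {\<rho>. A (butlast \<rho>) \<and> last \<rho> \<in> S}
       \<le> p * indicator {\<rho>. A \<rho>} \<rho>"
      unfolding AE_measure_pmf_iff
    proof
      fix \<rho> assume "\<rho> \<in> set_pmf ?H"
      then have "length \<rho> = Suc t" by (rule length_history)
      then show "measure_pmf.prob (extend_history M \<sigma> \<rho>) {\<rho>. A (butlast \<rho>) \<and> last \<rho> \<in> S} \<le> p * indicator {\<rho>. A \<rho>} \<rho>"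
        using assms by (auto simp: extend_history_def vimage_def split: split_indicator)
    qed
    show "integrable (measure_pmf ?H) (\<lambda>\<rho>. measure_pmf.prob (extend_history M \<sigma> \<rho>) {\<rho>. A (butlast \<rho>) \<and> last \<rho> \<in> S})"
      by (rule measure_pmf.integrable_const_bound[where B = 1]) auto
    show "integrable (measure_pmf ?H) (\<lambda>\<rho>. p * indicator {\<rho>. A \<rho>} \<rho>)"
      by (rule measure_pmf.integrable_const_bound[where B = p])
         (use assms(2) in \<open>auto split: split_indicator\<close>)
  qed
  also have "\<dots> = p * measure_pmf.prob ?H {\<rho>. A \<rho>}"
    by simp
  finally show ?thesis
    by (simp only: run_measure_prefix)
qed

section \<open>The joint chain of memory mode and history\<close>

definition mode_extend :: "(nat \<Rightarrow> nat \<times> 's \<Rightarrow> (nat \<times> 's) pmf) \<Rightarrow> nat \<times> 's list \<Rightarrow> (nat \<times> 's list) pmf" where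
  "mode_extend \<tau> = (\<lambda>(m, \<rho>). map_pmf (\<lambda>(m', s). (m', \<rho> @ [s])) (\<tau> (length \<rho> - 1) (m, last \<rho>)))"

lemma pmf_mode_extend:
  "pmf (mode_extend \<tau> (m', \<rho>')) (m, \<rho> @ [s]) =
     (if \<rho>' = \<rho> then pmf (\<tau> (length \<rho> - 1) (m', last \<rho>)) (m, s) else 0)"
proof (cases "\<rho>' = \<rho>")
  case True
  have "inj (\<lambda>(m', s). (m', \<rho> @ [s]))"
    by (auto simp: inj_def)
  from pmf_map_inj'[OF this, of _ "(m, s)"] show ?thesis
    using True by (simp add: mode_extend_def)
next
  case False
  then have "(m, \<rho> @ [s]) \<notin> set_pmf (mode_extend \<tau> (m', \<rho>'))"
    by (auto simp: mode_extend_def)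
  then show ?thesis
    using False by (simp add: set_pmf_iff)
qed

lemma mode_weight_snoc: "k < length \<rho> \<Longrightarrow> mode_weight B m0 \<tau> (\<rho> @ [s]) k m = mode_weight B m0 \<tau> \<rho> k m"
  by (induction k arbitrary: m) (auto simp: nth_append intro!: sum.cong)

lemma mode_history_invariant:
  assumes "m0 \<in> B" "memory_update M B \<tau>" "countable_mdp M" "s0 \<in> states M"
  shows "y \<in> set_pmf (iter_pmf (mode_extend \<tau>) k (m0, [s0])) \<Longrightarrow>
    fst y \<in> B \<and> last (snd y) \<in> states M \<and> length (snd y) = Suc k \<and> snd y ! 0 = s0"
proof (induction k arbitrary: y)
  case (Suc k)
  from Suc.prems obtain m \<rho> m' s where x: "(m, \<rho>) \<in> set_pmf (iter_pmf (mode_extend \<tau>) k (m0, [s0]))"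
    and s: "(m', s) \<in> set_pmf (\<tau> (length \<rho> - 1) (m, last \<rho>))" and y: "y = (m', \<rho> @ [s])"
    by (auto simp: mode_extend_def)
  have IH: "m \<in> B" "last \<rho> \<in> states M" "length \<rho> = Suc k" "\<rho> ! 0 = s0"
    using Suc.IH[OF x] by auto
  have tr: "transitions M \<subseteq> states M \<times> states M"
    using assms(3) by (simp add: countable_mdp_def)
  have "m' \<in> B \<and> s \<in> successors M (last \<rho>)"
  proof (cases "last \<rho> \<in> controlled M")
    case True
    then have "set_pmf (\<tau> (length \<rho> - 1) (m, last \<rho>)) \<subseteq> B \<times> successors M (last \<rho>)"
      using assms(2) IH(1) by (simp add: memory_update_def)
    then show ?thesis
      using s by blast
  next
    case False
    then have r: "last \<rho> \<in> random_states M"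
      using IH by (simp add: random_states_def)
    then have f: "fst ` set_pmf (\<tau> (length \<rho> - 1) (m, last \<rho>)) \<subseteq> B"
        "map_pmf snd (\<tau> (length \<rho> - 1) (m, last \<rho>)) = probs M (last \<rho>)"
      using assms(2) IH(1) by (simp_all add: memory_update_def)
    have "m' \<in> B"
      using f(1) s by (metis fst_conv image_subset_iff)
    moreover have "s \<in> set_pmf (probs M (last \<rho>))"
      using s unfolding f(2)[symmetric] set_map_pmf by (metis image_eqI snd_conv)
    moreover have "set_pmf (probs M (last \<rho>)) \<subseteq> successors M (last \<rho>)"
      using assms(3) r by (simp add: countable_mdp_def)
    ultimately show ?thesis
      by blast
  qed
  then have "m' \<in> B" "s \<in> states M"
    using tr by (auto simp: successors_def)
  then show ?case
    using IH by (simp add: y nth_append)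
qed (auto simp: assms)

lemma sum_Times_singleton: "(\<Sum>y\<in>B \<times> {r}. f y) = (\<Sum>m\<in>B. f (m, r))"
proof -
  have "B \<times> {r} = (\<lambda>m. (m, r)) ` B"
    by auto
  then show ?thesis
    by (simp add: sum.reindex inj_on_def)
qed

text \<open>\<open>mode_weight\<close> is the joint mass of the history and the current mode. The
  first state has to be fixed because the recursion for \<open>mode_weight\<close> starts with mass
  1 at any first state.\<close>

lemma pmf_mode_history:
  assumes "finite B" "m0 \<in> B" "memory_update M B \<tau>" "countable_mdp M" "s0 \<in> states M"
  shows "length \<rho> = Suc k \<Longrightarrow> \<rho> ! 0 = s0 \<Longrightarrow> m \<in> B \<Longrightarrow>
    pmf (iter_pmf (mode_extend \<tau>) k (m0, [s0])) (m, \<rho>) = mode_weight B m0 \<tau> \<rho> k m"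
proof (induction k arbitrary: \<rho> m)
  case 0
  then have "\<rho> = [s0]"
    by (cases \<rho>) auto
  then show ?case by (simp add: pmf_return)
next
  case (Suc k)
  let ?X = "iter_pmf (mode_extend \<tau>) k (m0, [s0])"
  obtain \<rho>' s where \<rho>: "\<rho> = \<rho>' @ [s]"
    using Suc.prems(1) by (cases \<rho> rule: rev_cases) auto
  have \<rho>': "length \<rho>' = Suc k" "\<rho>' ! 0 = s0"
    using Suc.prems by (auto simp: \<rho> nth_append)
  have last: "\<rho>' ! k = last \<rho>'"
    using \<rho>' by (cases \<rho>' rule: rev_cases) auto
  have "pmf (iter_pmf (mode_extend \<tau>) (Suc k) (m0, [s0])) (m, \<rho>)
      = (\<integral>y. pmf (mode_extend \<tau> y) (m, \<rho>) \<partial>measure_pmf ?X)"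
    by (simp add: pmf_bind)
  also have "\<dots> = (\<Sum>y\<in>B \<times> {\<rho>'}. pmf (mode_extend \<tau> y) (m, \<rho>) * pmf ?X y)"
  proof (rule integral_measure_pmf_real)
    fix y assume y: "y \<in> set_pmf ?X" "pmf (mode_extend \<tau> y) (m, \<rho>) \<noteq> 0"
    then show "y \<in> B \<times> {\<rho>'}"
      using mode_history_invariant[OF assms(2-5) y(1)]
      by (cases y) (auto simp: \<rho> pmf_mode_extend split: if_splits)
  qed (use assms in auto)
  also have "\<dots> = (\<Sum>m'\<in>B. pmf (mode_extend \<tau> (m', \<rho>')) (m, \<rho>) * pmf ?X (m', \<rho>'))"
    by (simp add: sum_Times_singleton)
  also have "\<dots> = (\<Sum>m'\<in>B. mode_weight B m0 \<tau> \<rho>' k m' * pmf (\<tau> k (m', last \<rho>')) (m, s))"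
    using \<rho>' by (intro sum.cong) (auto simp: \<rho> pmf_mode_extend Suc.IH)
  also have "\<dots> = mode_weight B m0 \<tau> \<rho> (Suc k) m"
    using \<rho>' by (simp add: \<rho> mode_weight_snoc nth_append last)
  finally show ?case .
qed

text \<open>Replacing \<open>\<sigma>\<close> by the joint chain loses nothing: the weights by which
  \<open>\<sigma>\<close> averages are the conditional mode probabilities given the history, so the
  next state has the same law in both. All estimates for finite memory are made in the joint
  chain.\<close>

lemma map_mode_history:
  assumes "finite B" "m0 \<in> B" "memory_update M B \<tau>" "countable_mdp M" "s0 \<in> states M"
    and "\<sigma> \<in> strategies M" "induced_by M B m0 \<tau> \<sigma>"
  shows "map_pmf snd (iter_pmf (mode_extend \<tau>) k (m0, [s0])) = history M s0 \<sigma> k"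
proof (induction k)
  case (Suc k)
  let ?X = "iter_pmf (mode_extend \<tau>) k (m0, [s0])" and ?H = "history M s0 \<sigma> k"
  have X: "m \<in> B \<and> last \<rho> \<in> states M \<and> length \<rho> = Suc k \<and> \<rho> ! 0 = s0" if "(m, \<rho>) \<in> set_pmf ?X" for m \<rho>
    using mode_history_invariant[OF assms(2-5) that] by simp
  have step: "map_pmf snd (mode_extend \<tau> (m, \<rho>)) =
      map_pmf (\<lambda>s. \<rho> @ [s]) (map_pmf snd (\<tau> (length \<rho> - 1) (m, last \<rho>)))" for m \<rho>
    by (simp add: mode_extend_def pmf.map_comp o_def case_prod_unfold)
  show ?case
  proof (rule pmf_eqI)
    fix \<rho>s
    show "pmf (map_pmf snd (iter_pmf (mode_extend \<tau>) (Suc k) (m0, [s0]))) \<rho>s = pmf (history M s0 \<sigma> (Suc k)) \<rho>s"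
    proof (cases \<rho>s rule: rev_cases)
      case Nil
      then have "\<rho>s \<notin> set_pmf (map_pmf snd (iter_pmf (mode_extend \<tau>) (Suc k) (m0, [s0])))"
        "\<rho>s \<notin> set_pmf (history M s0 \<sigma> (Suc k))"
        by (auto simp: mode_extend_def history_Suc extend_history_def)
      then show ?thesis
        by (metis set_pmf_iff)
    next
      case (snoc \<rho> s)
      define Q where "Q m = pmf (map_pmf snd (\<tau> k (m, last \<rho>))) s" for m
      \<comment> \<open>Summing out the mode gives the mass of the history, which is the normalising
        constant \<open>Z\<close> of \<open>induced_by\<close>.\<close>
      have H: "pmf ?H \<rho> = (\<Sum>m\<in>B. pmf ?X (m, \<rho>))"
      proof -
        have "pmf ?H \<rho> = measure_pmf.prob ?X (snd -` {\<rho>})"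
          by (simp add: Suc[symmetric] pmf_map)
        also have "\<dots> = measure_pmf.prob ?X (B \<times> {\<rho>})"
          by (rule measure_pmf.finite_measure_eq_AE) (auto simp: AE_measure_pmf_iff dest: X)
        also have "\<dots> = (\<Sum>y\<in>B \<times> {\<rho>}. pmf ?X y)"
          using assms by (simp add: measure_measure_pmf_finite)
        finally show ?thesis
          by (simp add: sum_Times_singleton)
      qed
      have "pmf (map_pmf snd (iter_pmf (mode_extend \<tau>) (Suc k) (m0, [s0]))) \<rho>s
          = (\<integral>y. pmf (map_pmf snd (mode_extend \<tau> y)) \<rho>s \<partial>measure_pmf ?X)"
        by (simp add: map_bind_pmf pmf_bind)
      also have "\<dots> = (\<Sum>y\<in>B \<times> {\<rho>}. pmf (map_pmf snd (mode_extend \<tau> y)) \<rho>s * pmf ?X y)"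
      proof (rule integral_measure_pmf_real)
        fix y assume y: "y \<in> set_pmf ?X" "pmf (map_pmf snd (mode_extend \<tau> y)) \<rho>s \<noteq> 0"
        obtain m \<rho>' where ym: "y = (m, \<rho>')" by (cases y)
        have "\<rho>' = \<rho>"
          using y(2) by (auto simp: ym step snoc set_pmf_iff[symmetric])
        then show "y \<in> B \<times> {\<rho>}"
          using X y(1) by (auto simp: ym)
      qed (use assms in auto)
      also have "\<dots> = (\<Sum>m\<in>B. pmf (map_pmf snd (mode_extend \<tau> (m, \<rho>))) \<rho>s * pmf ?X (m, \<rho>))"
        by (simp add: sum_Times_singleton)
      also have "\<dots> = (\<Sum>m\<in>B. pmf ?X (m, \<rho>) * Q m)"
      proof (rule sum.cong)
        fix m assume "m \<in> B"
        show "pmf (map_pmf snd (mode_extend \<tau> (m, \<rho>))) \<rho>s * pmf ?X (m, \<rho>) = pmf ?X (m, \<rho>) * Q m"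
        proof (cases "(m, \<rho>) \<in> set_pmf ?X")
          case True
          then have "length \<rho> = Suc k" using X by blast
          moreover have "pmf (map_pmf (\<lambda>s. \<rho> @ [s]) p) (\<rho> @ [s]) = pmf p s" for p
            using pmf_map_inj'[of "\<lambda>s. \<rho> @ [s]"] by (simp add: inj_def)
          ultimately show ?thesis
            by (simp add: step snoc Q_def)
        next
          case False
          then show ?thesis by (simp add: set_pmf_iff)
        qed
      qed simp
      also have "\<dots> = pmf ?H \<rho> * pmf (next_state M \<sigma> \<rho>) s"
      \<comment> \<open>Histories of mass 0 are treated apart, as \<open>induced_by\<close>
        constrains \<open>\<sigma>\<close> only where \<open>Z > 0\<close>.\<close>
      proof (cases "pmf ?H \<rho> = 0")
        case True
        then have "\<forall>m\<in>B. pmf ?X (m, \<rho>) = 0"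
          using assms(1) by (simp add: H sum_nonneg_eq_0_iff)
        then show ?thesis
          using True by simp
      next
        case False
        then have \<rho>H: "\<rho> \<in> set_pmf ?H"
          by (simp add: set_pmf_iff)
        then have pr: "partial_run M \<rho>" and len: "length \<rho> = Suc k" and hd: "\<rho> ! 0 = s0"
          using partial_run_history[OF assms(4-6)] length_history nth_0_history by metis+
        have w: "pmf ?X (m, \<rho>) = mode_weight B m0 \<tau> \<rho> k m" if "m \<in> B" for m
          using pmf_mode_history[OF assms(1-5) len hd that] .
        have HZ: "pmf ?H \<rho> = (\<Sum>m\<in>B. mode_weight B m0 \<tau> \<rho> k m)"
          by (simp add: H w)
        have Z: "(\<Sum>m\<in>B. mode_weight B m0 \<tau> \<rho> k m) > 0"
          using False pmf_nonneg[of ?H \<rho>] unfolding HZ by linarith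
        show ?thesis
        proof (cases "last \<rho> \<in> controlled M")
          case True
          have "pmf (\<sigma> \<rho>) s = (\<Sum>m\<in>B. mode_weight B m0 \<tau> \<rho> k m / pmf ?H \<rho> * Q m)"
            using assms(7) pr True Z len unfolding induced_by_def HZ Q_def by (simp add: Let_def)
          then show ?thesis
            using False True by (simp add: next_state_def sum_distrib_left w)
        next
          case nc: False
          have "last \<rho> \<in> states M"
            using pr by (auto simp: partial_run_def)
          then have "last \<rho> \<in> random_states M"
            using nc by (simp add: random_states_def)
          then have "Q m = pmf (probs M (last \<rho>)) s" if "m \<in> B" for m
            using assms(3) that by (simp add: memory_update_def Q_def)
          then show ?thesis
            using nc by (simp add: next_state_def H sum_distrib_right)
        qed
      qed
      finally show ?thesis
        by (simp only: snoc pmf_history_snoc)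
    qed
  qed
qed simp


section \<open>The schedule of gadgets and the payoff of tag paths\<close>

definition block_index :: "(nat \<Rightarrow> nat) \<Rightarrow> nat \<Rightarrow> nat" where
  "block_index N t = (LEAST n. t < N (Suc n))"

lemma block_index_eq:
  assumes "strict_mono N" "N n \<le> t" "t < N (Suc n)"
  shows "block_index N t = n"
  unfolding block_index_def
proof (rule Least_equality)
  fix k assume "t < N (Suc k)"
  then have "N n < N (Suc k)"
    using assms(2) by simp
  then show "n \<le> k"
    using strict_mono_less[OF assms(1), of n "Suc k"] by simp
qed (rule assms)

lemma block_index_bounds:
  assumes "strict_mono N" "N 0 = 0"
  shows "N (block_index N t) \<le> t" "t < N (Suc (block_index N t))"
proof -
  have ex: "t < N (Suc t)"
    using strict_mono_imp_increasing[OF assms(1), of "Suc t"] by simp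
  then show "t < N (Suc (block_index N t))"
    unfolding block_index_def by (rule LeastI)
  show "N (block_index N t) \<le> t"
  proof (cases "block_index N t")
    case (Suc k)
    then have "\<not> t < N (Suc k)"
      using not_less_Least[of k "\<lambda>n. t < N (Suc n)"] by (simp add: block_index_def)
    then show ?thesis
      using Suc by simp
  qed (simp add: assms)
qed

text \<open>
  There are \<open>2^(k^2)\<close> gadgets of level \<open>k\<close>; the first one has index \<open>level_start k\<close>.
\<close>

definition level_start :: "nat \<Rightarrow> nat" where
  "level_start k = (\<Sum>l<k. 2 ^ (l * l))"

definition level :: "nat \<Rightarrow> nat" where
  "level = block_index level_start"

lemma strict_mono_level_start: "strict_mono level_start"
  unfolding strict_mono_Suc_iff by (simp add: level_start_def)

lemma level_eq: "level_start k \<le> n \<Longrightarrow> n < level_start (Suc k) \<Longrightarrow> level n = k"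
  unfolding level_def by (rule block_index_eq[OF strict_mono_level_start])

lemma level_ge: "level_start k \<le> n \<Longrightarrow> k \<le> level n"
  using block_index_bounds(2)[OF strict_mono_level_start, of n]
    strict_mono_less[OF strict_mono_level_start, of k "Suc (level n)"]
  by (simp add: level_def level_start_def)

text \<open>
  Gadget \<open>n\<close> occupies the time interval from \<open>gadget_start n\<close> to \<open>gadget_start (Suc n)\<close>. It consists of two
  halves of equal length, one for nature and one for the player, each with \<open>level n\<close> steps that
  choose a counter, a risk step, \<open>level n * Suc (gadget_start n)\<close> steps that pay the counter in units of
  \<open>Suc (gadget_start n)\<close>, and a step that forgets the counter.
\<close>

primrec gadget_start :: "nat \<Rightarrow> nat" where
  "gadget_start 0 = 0"
| "gadget_start (Suc n) = gadget_start n + 2 * (level n + 2 + level n * Suc (gadget_start n))"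

definition half_length :: "nat \<Rightarrow> nat" where
  "half_length n = level n + 2 + level n * Suc (gadget_start n)"

text \<open>\<open>h\<close> is False in nature's half and True in the player's half.\<close>

definition half_start :: "nat \<Rightarrow> bool \<Rightarrow> nat" where
  "half_start n h = gadget_start n + (if h then half_length n else 0)"

lemma half_start_False [simp]: "half_start n False = gadget_start n"
  by (simp add: half_start_def)

lemma half_start_add:
  "gadget_start n + half_length n = half_start n True"
  "half_start n True + half_length n = gadget_start (Suc n)"
  by (simp_all add: half_start_def half_length_def)

declare gadget_start.simps(2) [simp del]

lemma half_length_gt: "Suc (level n) < half_length n"
  by (simp add: half_length_def)

lemma gadget_start_Suc: "gadget_start (Suc n) = gadget_start n + 2 * half_length n"
  by (simp add: half_length_def gadget_start.simps)

lemma strict_mono_gadget_start: "strict_mono gadget_start"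
  unfolding strict_mono_Suc_iff by (simp add: gadget_start_Suc half_length_def)

definition gadget :: "nat \<Rightarrow> nat" where
  "gadget = block_index gadget_start"

definition second_half :: "nat \<Rightarrow> bool" where
  "second_half t \<longleftrightarrow> half_start (gadget t) True \<le> t"

definition offset :: "nat \<Rightarrow> nat" where
  "offset t = t - half_start (gadget t) (second_half t)"

lemma phase [simp]:
  assumes "i < half_length n"
  shows "gadget (half_start n h + i) = n" "second_half (half_start n h + i) = h"
    "offset (half_start n h + i) = i"
proof -
  show g: "gadget (half_start n h + i) = n"
    unfolding gadget_def
    by (rule block_index_eq[OF strict_mono_gadget_start])
       (use assms in \<open>auto simp: half_start_def gadget_start_Suc\<close>)
  show s: "second_half (half_start n h + i) = h"
    unfolding second_half_def g using assms by (auto simp: half_start_def)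
  show "offset (half_start n h + i) = i"
    unfolding offset_def g s by simp
qed

lemma time_cases:
  obtains n h i where "t = half_start n h + i" "i < half_length n"
proof -
  let ?n = "gadget t"
  have b: "gadget_start ?n \<le> t" "t < gadget_start ?n + 2 * half_length ?n"
    using block_index_bounds[OF strict_mono_gadget_start, of t]
    by (simp_all add: gadget_def gadget_start_Suc)
  show ?thesis
    by (rule that[of ?n "second_half t" "offset t"])
       (use b in \<open>auto simp: offset_def second_half_def half_start_def\<close>)
qed

text \<open>
  The tag \<open>0\<close> means lost, the tag \<open>Suc c\<close> means that the counter is \<open>c\<close>. At offset \<open>i < level n\<close> the
  counter can still be increased only if it equals \<open>i\<close>.
\<close>

definition next_tags :: "nat \<Rightarrow> bool \<Rightarrow> nat \<Rightarrow> nat \<Rightarrow> nat set" where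
  "next_tags n h i d =
     (if d = 0 then {0}
      else if i < level n then (if d = Suc i then {d, Suc d} else {d})
      else if i = level n then (if h \<and> d \<le> level n then {0, d} else {d})
      else if Suc i = half_length n then {1} else {d})"

text \<open>After the risk step at offset \<open>level n\<close>, a tag \<open>Suc c\<close> pays
  one unit in each of the first \<open>c * Suc (gadget_start n)\<close> steps, and the half
  determines the sign. A lost run pays -1 forever.\<close>

definition tag_reward :: "nat \<Rightarrow> bool \<Rightarrow> nat \<Rightarrow> nat \<Rightarrow> real" where
  "tag_reward n h i d =
     (if d = 0 then -1
      else if level n < i \<and> i - Suc (level n) < (d - 1) * Suc (gadget_start n)
      then (if h then -1 else 1) else 0)"

text \<open>Stated for an arbitrary sequence of tags, so that it applies to infinite runs as well as
  to the finite histories of the joint chain.\<close>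

locale half_path =
  fixes n :: nat and h :: bool and e :: "nat \<Rightarrow> nat"
  assumes step: "i < half_length n \<Longrightarrow> e (Suc i) \<in> next_tags n h i (e i)"
    and start: "e 0 = 1"
begin

lemma choose_bounds: "i \<le> level n \<Longrightarrow> 1 \<le> e i \<and> e i \<le> Suc i"
proof (induction i)
  case (Suc i)
  then show ?case
    using step[of i] half_length_gt[of n] by (auto simp: next_tags_def split: if_splits)
qed (simp add: start)

text \<open>A counter that once lags behind the offset is frozen, so its final value determines all
  earlier ones and in particular the step at which it stopped.\<close>

lemma choose_min:
  assumes "k \<le> i" "i \<le> level n"
  shows "e k = min (Suc k) (e i)"
  using assms
proof (induction i arbitrary: k)
  case 0
  then show ?case by (simp add: start)
next
  case (Suc i)
  have "e (Suc i) \<in> next_tags n h i (e i)"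
    using Suc.prems half_length_gt[of n] by (intro step) simp
  then have *: "e (Suc i) = e i \<or> e i = Suc i \<and> e (Suc i) = Suc (Suc i)"
    using Suc.prems choose_bounds[of i] by (auto simp: next_tags_def split: if_splits)
  show ?case
  proof (cases "k = Suc i")
    case True
    then show ?thesis
      using Suc.prems choose_bounds[of "Suc i"] by simp
  next
    case False
    then have k: "k \<le> i" and "e k = min (Suc k) (e i)"
      using Suc.prems Suc.IH[of k] by simp_all
    then show ?thesis
      using * by auto
  qed
qed

lemma risk: "e (Suc (level n)) = e (level n) \<or> h \<and> e (level n) \<le> level n \<and> e (Suc (level n)) = 0"
  using step[of "level n"] half_length_gt[of n] choose_bounds[of "level n"]
  by (auto simp: next_tags_def split: if_splits)

lemma pay: "level n < i \<Longrightarrow> i < half_length n \<Longrightarrow> e i = e (Suc (level n))"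
proof (induction i)
  case (Suc i)
  show ?case
  proof (cases "i = level n")
    case False
    then have "e i = e (Suc (level n))"
      using Suc.prems by (intro Suc.IH) auto
    moreover have "e (Suc i) \<in> next_tags n h i (e i)"
      using Suc.prems by (intro step) auto
    ultimately show ?thesis
      using Suc.prems False by (auto simp: next_tags_def split: if_splits)
  qed simp
qed simp

lemma merge: "e (half_length n) = (if e (Suc (level n)) = 0 then 0 else 1)"
proof -
  have "e (half_length n - 1) = e (Suc (level n))"
    using half_length_gt[of n] by (intro pay) auto
  then show ?thesis
    using step[of "half_length n - 1"] half_length_gt[of n]
    by (auto simp: next_tags_def split: if_splits)
qed

text \<open>Partial sums are needed because the liminf sees every time and not only the ends of
  gadgets. Before the payment starts, the subtraction truncates to 0.\<close>

lemma sum_reward: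
  assumes "e (Suc (level n)) = Suc c" "i \<le> half_length n"
  shows "(\<Sum>k<i. tag_reward n h k (e k)) =
    (if h then -1 else 1) * real (min (i - Suc (level n)) (c * Suc (gadget_start n)))"
  using assms(2)
proof (induction i)
  case (Suc i)
  have "e i \<noteq> 0"
    using choose_bounds[of i] pay[of i] assms(1) Suc.prems by (cases "i \<le> level n") auto
  moreover have "e i = Suc c" if "level n < i"
    using pay[of i] that assms(1) Suc.prems by simp
  ultimately have "tag_reward n h i (e i) =
      (if level n < i \<and> i - Suc (level n) < c * Suc (gadget_start n) then (if h then -1 else 1) else 0)"
    by (auto simp: tag_reward_def)
  moreover have "min (Suc i - Suc (level n)) (c * Suc (gadget_start n)) =
      min (i - Suc (level n)) (c * Suc (gadget_start n)) +
      (if level n < i \<and> i - Suc (level n) < c * Suc (gadget_start n) then 1 else 0)"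
    by (cases "level n < i") (auto simp: min_def not_less Suc_diff_le)
  ultimately show ?case
    using Suc by (auto simp: algebra_simps)
qed simp

lemma choice_le: "e (level n) - 1 \<le> level n"
  using choose_bounds[of "level n"] by linarith

lemma sum_reward_half:
  assumes "e (Suc (level n)) \<noteq> 0"
  shows "(\<Sum>k<half_length n. tag_reward n h k (e k)) =
    (if h then -1 else 1) * real ((e (level n) - 1) * Suc (gadget_start n))"
proof -
  have e: "e (Suc (level n)) = Suc (e (level n) - 1)"
    using risk assms by auto
  have "(e (level n) - 1) * Suc (gadget_start n) \<le> level n * Suc (gadget_start n)"
    using choice_le by (intro mult_right_mono) auto
  then have "min (half_length n - Suc (level n)) ((e (level n) - 1) * Suc (gadget_start n)) =
      (e (level n) - 1) * Suc (gadget_start n)"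
    by (simp add: half_length_def)
  then show ?thesis
    unfolding sum_reward[OF e order_refl] by (simp only:)
qed

end

section \<open>Payoffs along infinite tag paths\<close>

definition tag_path :: "(nat \<Rightarrow> nat) \<Rightarrow> bool" where
  "tag_path d \<longleftrightarrow> d 0 = 1 \<and> (\<forall>t. d (Suc t) \<in> next_tags (gadget t) (second_half t) (offset t) (d t))"

definition payoff :: "(nat \<Rightarrow> nat) \<Rightarrow> nat \<Rightarrow> real" where
  "payoff d t = (\<Sum>j<t. tag_reward (gadget j) (second_half j) (offset j) (d j))"

text \<open>A lost run, with tag 0, also gets the value 0 here; statements about
  \<open>counter\<close> therefore assume that the tags concerned are not 0.\<close>

definition counter :: "(nat \<Rightarrow> nat) \<Rightarrow> nat \<Rightarrow> bool \<Rightarrow> nat" where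
  "counter d n h = d (half_start n h + level n) - 1"

text \<open>Loss is tested at the end of the gadget; being absorbing, it makes every later gadget
  fail as well. The event is determined by the tags up to time
  \<open>gadget_start (Suc n)\<close>.\<close>

definition gadget_fails :: "(nat \<Rightarrow> nat) \<Rightarrow> nat \<Rightarrow> bool" where
  "gadget_fails d n \<longleftrightarrow>
     d (half_start n False + level n) < d (half_start n True + level n) \<or> d (gadget_start (Suc n)) = 0"

text \<open>This is the reason for the unit \<open>Suc (gadget_start n)\<close>: a single unit
  outweighs everything earned or owed before gadget \<open>n\<close>.\<close>

lemma abs_payoff_le: "\<bar>payoff d t\<bar> \<le> real t"
proof (induction t)
  case (Suc t)
  have "\<bar>tag_reward (gadget t) (second_half t) (offset t) (d t)\<bar> \<le> 1"
    by (simp add: tag_reward_def)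
  then show ?case
    using Suc by (simp add: payoff_def)
qed (simp add: payoff_def)

lemma payoff_add:
  "i \<le> half_length n \<Longrightarrow>
   payoff d (half_start n h + i) = payoff d (half_start n h) + (\<Sum>k<i. tag_reward n h k (d (half_start n h + k)))"
  by (induction i) (simp_all add: payoff_def)

lemma lost_absorbing:
  assumes "tag_path d" "d t = 0"
  shows "d (t + k) = 0" "payoff d (t + k) = payoff d t - real k"
proof -
  show *: "d (t + k) = 0" for k
  proof (induction k)
    case (Suc k)
    have "d (Suc (t + k)) \<in> next_tags (gadget (t + k)) (second_half (t + k)) (offset (t + k)) (d (t + k))"
      using assms(1) by (simp add: tag_path_def)
    then show ?case
      by (simp add: Suc next_tags_def)
  qed (simp add: assms)
  show "payoff d (t + k) = payoff d t - real k"
    by (induction k) (simp_all add: payoff_def tag_reward_def *)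
qed

lemma half_path_tag_path:
  assumes "tag_path d" "d (half_start n h) = 1"
  shows "half_path n h (\<lambda>i. d (half_start n h + i))"
proof
  fix i assume "i < half_length n"
  then show "d (half_start n h + Suc i) \<in> next_tags n h i (d (half_start n h + i))"
    using assms(1)[unfolded tag_path_def, THEN conjunct2, rule_format, of "half_start n h + i"] by simp
qed (simp add: assms)

lemma never_lost_gadget_start:
  assumes d: "tag_path d" and pos: "\<And>t. d t \<noteq> 0"
  shows "d (half_start n h) = 1"
proof -
  have *: "d (half_start n h + half_length n) = 1" if "d (half_start n h) = 1" for n h
  proof -
    interpret half_path n h "\<lambda>i. d (half_start n h + i)"
      by (rule half_path_tag_path[OF d that])
    show ?thesis using merge pos by (simp split: if_splits)
  qed
  have "d (gadget_start n) = 1" for n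
  proof (induction n)
    case 0
    then show ?case using d by (simp add: tag_path_def)
  next
    case (Suc n)
    then show ?case using *[of n False] *[of n True] by (simp add: half_start_add)
  qed
  then show ?thesis
    using *[of n False] by (cases h) (auto simp: half_start_add)
qed

lemma never_lost_payoff:
  assumes d: "tag_path d" and pos: "\<And>t. d t \<noteq> 0"
  shows "payoff d (gadget_start (Suc n)) = payoff d (gadget_start n) +
      (real (counter d n False) - real (counter d n True)) * real (Suc (gadget_start n))"
    and "counter d n h \<le> level n"
proof -
  have half: "payoff d (half_start n h + half_length n) = payoff d (half_start n h) +
      (if h then -1 else 1) * real (counter d n h * Suc (gadget_start n)) \<and> counter d n h \<le> level n" for h
  proof -
    interpret half_path n h "\<lambda>i. d (half_start n h + i)"
      by (rule half_path_tag_path[OF d never_lost_gadget_start[OF d pos]])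
    show ?thesis
      using sum_reward_half pos choice_le unfolding counter_def by (simp add: payoff_add)
  qed
  then show "counter d n h \<le> level n" by blast
  show "payoff d (gadget_start (Suc n)) = payoff d (gadget_start n) +
      (real (counter d n False) - real (counter d n True)) * real (Suc (gadget_start n))"
    using half[of False] half[of True] unfolding half_start_False half_start_add by (simp add: algebra_simps)
qed

text \<open>Nature's half never lowers the total, and the player's half gives back at most what was
  just paid.\<close>

lemma payoff_nonneg:
  assumes d: "tag_path d" and pos: "\<And>t. d t \<noteq> 0"
    and start: "payoff d (gadget_start n) \<ge> 0" and le: "counter d n True \<le> counter d n False"
    and t: "gadget_start n \<le> t" "t \<le> gadget_start (Suc n)"
  shows "payoff d t \<ge> 0"
proof -
  have half: "payoff d (half_start n h + i) = payoff d (half_start n h) +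
      (if h then -1 else 1) * real (min (i - Suc (level n)) (counter d n h * Suc (gadget_start n)))"
    if "i \<le> half_length n" for h i
  proof -
    interpret half_path n h "\<lambda>i. d (half_start n h + i)"
      by (rule half_path_tag_path[OF d never_lost_gadget_start[OF d pos]])
    have "d (half_start n h + Suc (level n)) = Suc (counter d n h)"
      using risk pos unfolding counter_def by auto
    from sum_reward[OF this that] show ?thesis
      using that by (simp only: payoff_add)
  qed
  have cl: "counter d n h * Suc (gadget_start n) \<le> level n * Suc (gadget_start n)" for h
    using never_lost_payoff(2)[OF d pos] by (intro mult_right_mono) auto
  have "min (half_length n - Suc (level n)) (counter d n False * Suc (gadget_start n)) = counter d n False * Suc (gadget_start n)"
    using cl[of False] by (simp add: half_length_def)
  then have mid: "payoff d (half_start n True) = payoff d (gadget_start n) + real (counter d n False * Suc (gadget_start n))"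
    using half[of "half_length n" False] by (simp add: half_start_add)
  show ?thesis
  proof (cases "t \<le> half_start n True")
    case True
    then have "t = half_start n False + (t - gadget_start n)" "t - gadget_start n \<le> half_length n"
      using t by (auto simp: half_start_def)
    then show ?thesis
      using half[of "t - gadget_start n" False] start by simp
  next
    case False
    then have *: "t = half_start n True + (t - half_start n True)" "t - half_start n True \<le> half_length n"
      using t by (auto simp: half_start_def gadget_start_Suc)
    have "counter d n True * Suc (gadget_start n) \<le> counter d n False * Suc (gadget_start n)"
      using le by (intro mult_right_mono) auto
    then have "real (min (t - half_start n True - Suc (level n)) (counter d n True * Suc (gadget_start n))) \<le> 
        real (counter d n False * Suc (gadget_start n))"
      by linarith
    then show ?thesis
      using half[OF *(2), of True] *(1) start mid by simp
  qed
qed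

text \<open>One surplus unit in gadget \<open>n0\<close> cancels any debt, because the debt is at
  most \<open>gadget_start n0\<close>; from then on no gadget takes the total below 0.\<close>

lemma good_path_wins:
  assumes d: "tag_path d" and pos: "\<And>t. d t \<noteq> 0"
    and gain: "counter d n0 True < counter d n0 False"
    and le: "\<And>n. n0 < n \<Longrightarrow> counter d n True \<le> counter d n False"
  shows "0 \<le> liminf (\<lambda>t. ereal (payoff d t))"
proof (rule Liminf_bounded)
  have s: "payoff d (gadget_start n) \<ge> 0" if "n0 < n" for n
    using that
  proof (induction n)
    case (Suc n)
    show ?case
    proof (cases "n0 = n")
      case True
      have "1 * real (Suc (gadget_start n)) \<le> (real (counter d n False) - real (counter d n True)) * real (Suc (gadget_start n))"
        using gain True by (intro mult_right_mono) auto
      then have "payoff d (gadget_start n) + real (Suc (gadget_start n)) \<le> payoff d (gadget_start (Suc n))"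
        unfolding never_lost_payoff(1)[OF d pos] by (simp only: mult_1 add_left_mono)
      then show ?thesis
        using abs_payoff_le[of d "gadget_start n"] by simp
    next
      case False
      then show ?thesis
        using Suc payoff_nonneg[OF d pos _ le, of n "gadget_start (Suc n)"]
        by (simp add: gadget_start_Suc)
    qed
  qed simp
  have "payoff d t \<ge> 0" if "gadget_start (Suc n0) \<le> t" for t
  proof -
    let ?n = "gadget t"
    have b: "gadget_start ?n \<le> t" "t < gadget_start (Suc ?n)"
      using block_index_bounds[OF strict_mono_gadget_start, of t] by (simp_all add: gadget_def)
    then have "gadget_start (Suc n0) < gadget_start (Suc ?n)"
      using that by simp
    then have "n0 < ?n"
      by (simp add: strict_mono_less[OF strict_mono_gadget_start])
    then show ?thesis
      using payoff_nonneg[OF d pos s le] b by simp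
  qed
  then show "eventually (\<lambda>t. 0 \<le> ereal (payoff d t)) sequentially"
    by (auto simp: eventually_sequentially)
qed

lemma winning_path:
  assumes d: "tag_path d" and win: "0 \<le> liminf (\<lambda>t. ereal (payoff d t))"
  shows "\<exists>n0. \<forall>n\<ge>n0. \<not> gadget_fails d n"
proof -
  \<comment> \<open>Any bound strictly between -1 and 0 would do: a failure pushes the total to -1
    or lower.\<close>
  have "eventually (\<lambda>t. ereal (- 1 / 2) < ereal (payoff d t)) sequentially"
    by (rule less_LiminfD, rule less_le_trans[OF _ win]) simp
  then obtain t0 where t0: "\<And>t. t0 \<le> t \<Longrightarrow> - 1 / 2 < payoff d t"
    by (auto simp: eventually_sequentially)
  have pos: "d t \<noteq> 0" for t
  proof
    assume "d t = 0"
    \<comment> \<open>The total at the loss is at most \<open>t\<close>, so after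
      \<open>t0 + t + 1\<close> further steps of -1 it is at most -1, at a time beyond
      \<open>t0\<close>.\<close>
    from lost_absorbing(2)[OF d this, of "t0 + t + 1"] t0[of "t + (t0 + t + 1)"] abs_payoff_le[of d t]
    show False by simp
  qed
  have "\<not> gadget_fails d n" if "t0 \<le> n" for n
  proof
    assume "gadget_fails d n"
    then have "counter d n False < counter d n True"
      using pos[of "gadget_start (Suc n)"] pos[of "half_start n False + level n"]
      unfolding gadget_fails_def counter_def by linarith
    then have "(real (counter d n False) - real (counter d n True)) * real (Suc (gadget_start n)) \<le> (-1) * real (Suc (gadget_start n))"
      by (intro mult_right_mono) auto
    then have "payoff d (gadget_start (Suc n)) \<le> payoff d (gadget_start n) + - 1 * real (Suc (gadget_start n))"
      unfolding never_lost_payoff(1)[OF d pos] by (rule add_left_mono)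
    then have "payoff d (gadget_start (Suc n)) \<le> -1"
      using abs_payoff_le[of d "gadget_start n"] by simp
    moreover have "t0 \<le> gadget_start (Suc n)"
      using that strict_mono_imp_increasing[OF strict_mono_gadget_start, of "Suc n"] by simp
    ultimately show False
      using t0[of "gadget_start (Suc n)"] by simp
  qed
  then show ?thesis by blast
qed


section \<open>The MDP\<close>

definition mix :: "real \<Rightarrow> 'a \<Rightarrow> 'a \<Rightarrow> 'a pmf" where
  "mix p x y = map_pmf (\<lambda>b. if b then x else y) (bernoulli_pmf p)"

lemma mem_set_pmf_mix: "z \<in> set_pmf (mix p x y) \<Longrightarrow> z = x \<or> z = y"
  by (auto simp: mix_def)

lemma pmf_mix:
  assumes "0 \<le> p" "p \<le> 1" "x \<noteq> y"
  shows "pmf (mix p x y) z = (if z = x then p else if z = y then 1 - p else 0)"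
proof -
  have "(\<lambda>b. if b then x else y) -` {z} = (if z = x then {True} else if z = y then {False} else {})"
    using assms by (auto split: if_splits)
  then show ?thesis
    using assms by (simp add: mix_def pmf_map measure_pmf_single)
qed

definition ratio :: "nat \<Rightarrow> real" where
  "ratio n = (1 / 2) ^ level n"

lemma ratio_bounds: "0 < ratio n" "ratio n \<le> 1"
  by (simp_all add: ratio_def power_le_one)

lemma ratio_power_le_one: "ratio n ^ k \<le> 1"
  using ratio_bounds[of n] by (simp add: power_le_one)

text \<open>Because the tag is one more than the counter, the exponent \<open>d\<close> of the risk
  step is \<open>j + 1\<close> for the player's counter \<open>j\<close>. A full counter,
  \<open>d = Suc (level n)\<close>, runs no risk.\<close>

definition tag_law :: "nat \<Rightarrow> bool \<Rightarrow> nat \<Rightarrow> nat \<Rightarrow> nat pmf" where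
  "tag_law n h i d =
     (if d = 0 then return_pmf 0
      else if i < level n then
        (if d = Suc i then mix (ratio n ^ (level n - i)) d (Suc d) else return_pmf d)
      else if i = level n then
        (if h \<and> d \<le> level n then mix (ratio n ^ d) 0 d else return_pmf d)
      else return_pmf (if Suc i = half_length n then 1 else d))"

lemma set_pmf_tag_law: "set_pmf (tag_law n h i d) \<subseteq> next_tags n h i d"
  by (auto simp: tag_law_def next_tags_def dest!: mem_set_pmf_mix)

lemma pmf_tag_law_rat: "pmf (tag_law n h i d) d' \<in> \<rat>"
proof -
  have r: "ratio n ^ k \<in> \<rat>" for k
    by (auto simp: ratio_def intro!: Rats_power Rats_divide)
  have "pmf (mix (ratio n ^ k) x (Suc x)) d' \<in> \<rat>" for k x
    using r[of k] ratio_bounds[of n] by (subst pmf_mix) (auto simp: power_le_one)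
  moreover have "pmf (mix (ratio n ^ k) 0 x) d' \<in> \<rat>" if "x \<noteq> 0" for k x
    using r[of k] ratio_bounds[of n] that by (subst pmf_mix) (auto simp: power_le_one)
  moreover have "pmf (return_pmf x) d' \<in> \<rat>" for x
    by (simp add: indicator_def)
  ultimately show ?thesis
    unfolding tag_law_def by (simp split: if_split)
qed

text \<open>A state is a pair of time and tag, coded as a natural number. Carrying the time makes
  the transition graph acyclic and the step counter implicit.\<close>

definition time :: "nat \<Rightarrow> nat" where "time s = fst (prod_decode s)"
definition tag :: "nat \<Rightarrow> nat" where "tag s = snd (prod_decode s)"
definition state :: "nat \<Rightarrow> nat \<Rightarrow> nat" where "state t d = prod_encode (t, d)"

lemma time_state [simp]: "time (state t d) = t"
  and tag_state [simp]: "tag (state t d) = d"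
  and state_time_tag [simp]: "state (time s) (tag s) = s"
  by (simp_all add: time_def tag_def state_def)

lemma state_inject [simp]: "state t d = state t' d' \<longleftrightarrow> t = t' \<and> d = d'"
  by (metis time_state tag_state)

text \<open>All pairs of time and tag are states, also those that no run from \<open>initial\<close>
  visits, and the structural claims are proved for all of them. The player moves exactly where the
  counter of the second half can still be increased.\<close>

definition gadgets :: "nat mdp" where
  "gadgets =
     \<lparr>states = UNIV,
      controlled = {s. second_half (time s) \<and> offset (time s) < level (gadget (time s)) \<and>
                       tag s = Suc (offset (time s))},
      transitions = {(s, s'). time s' = Suc (time s) \<and>
        tag s' \<in> next_tags (gadget (time s)) (second_half (time s)) (offset (time s)) (tag s)},
      probs = (\<lambda>s. map_pmf (state (Suc (time s)))
        (tag_law (gadget (time s)) (second_half (time s)) (offset (time s)) (tag s))),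
      reward = (\<lambda>(s, s'). tag_reward (gadget (time s)) (second_half (time s)) (offset (time s)) (tag s))\<rparr>"

definition initial :: nat where "initial = state 0 1"

lemma states_gadgets [simp]: "states gadgets = UNIV"
  by (simp add: gadgets_def)

lemma in_transitions:
  "(s, s') \<in> transitions gadgets \<longleftrightarrow> time s' = Suc (time s) \<and>
     tag s' \<in> next_tags (gadget (time s)) (second_half (time s)) (offset (time s)) (tag s)"
  by (simp add: gadgets_def)

lemma in_successors: "s' \<in> successors gadgets s \<longleftrightarrow> (s, s') \<in> transitions gadgets"
  by (simp add: successors_def)

lemma successors_eq:
  "successors gadgets s = state (Suc (time s)) `
     next_tags (gadget (time s)) (second_half (time s)) (offset (time s)) (tag s)"
proof (intro set_eqI iffI)
  fix s' assume "s' \<in> successors gadgets s"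
  then have "tag s' \<in> next_tags (gadget (time s)) (second_half (time s)) (offset (time s)) (tag s)"
    "s' = state (Suc (time s)) (tag s')"
    by (simp_all add: in_successors in_transitions) (metis state_time_tag)
  then show "s' \<in> state (Suc (time s)) `
     next_tags (gadget (time s)) (second_half (time s)) (offset (time s)) (tag s)"
    by blast
qed (auto simp: in_successors in_transitions)

lemma in_controlled:
  "i < half_length n \<Longrightarrow> state (half_start n h + i) d \<in> controlled gadgets \<longleftrightarrow> h \<and> i < level n \<and> d = Suc i"
  by (simp add: gadgets_def)

lemma probs_gadgets:
  "i < half_length n \<Longrightarrow> probs gadgets (state (half_start n h + i) d) =
     map_pmf (state (Suc (half_start n h + i))) (tag_law n h i d)"
  by (simp add: gadgets_def)

lemma pmf_probs_gadgets:
  "i < half_length n \<Longrightarrow> pmf (probs gadgets (state (half_start n h + i) d)) (state (Suc (half_start n h + i)) d') =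
     pmf (tag_law n h i d) d'"
  by (simp add: probs_gadgets pmf_map_inj' inj_def)

lemma next_tags_nonempty: "next_tags n h i d \<noteq> {}"
  by (simp add: next_tags_def)

lemma card_next_tags: "finite (next_tags n h i d)" "card (next_tags n h i d) \<le> 2"
  by (auto simp: next_tags_def card_insert_if)

lemma countable_mdp_gadgets: "countable_mdp gadgets"
proof -
  have "set_pmf (probs gadgets s) \<subseteq> successors gadgets s" for s
    unfolding successors_eq by (auto simp: gadgets_def dest!: subsetD[OF set_pmf_tag_law])
  then show ?thesis
    by (auto simp: countable_mdp_def successors_eq next_tags_nonempty)
qed

lemma card_successors: "finite (successors gadgets s)" "card (successors gadgets s) \<le> 2"
  using card_next_tags by (auto simp: successors_eq intro: order_trans[OF card_image_le])

lemma acyclic_gadgets: "acyclic (transitions gadgets)"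
proof -
  have "acyclic (Wellfounded.measure time)"
    by (simp add: wf_acyclic)
  then show ?thesis
    by (rule acyclic_subset) (auto simp: in_transitions)
qed

lemma time_partial_run:
  "partial_run gadgets \<rho> \<Longrightarrow> time (last \<rho>) = time (hd \<rho>) + (length \<rho> - 1)"
proof (induction \<rho> rule: rev_induct)
  case (snoc s \<rho>)
  show ?case
  proof (cases "\<rho> = []")
    case False
    then have "partial_run gadgets \<rho>" "(last \<rho>, s) \<in> transitions gadgets"
      using snoc.prems by (auto simp: partial_run_def successively_append_iff)
    then show ?thesis
      using snoc.IH False by (cases \<rho>) (auto simp: in_transitions)
  qed simp
qed (simp add: partial_run_def)

lemma step_counter_implicit_gadgets: "step_counter_implicit gadgets s0"
  unfolding step_counter_implicit_def
proof (intro ballI allI impI)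
  fix s \<rho> \<rho>'
  assume a: "partial_run gadgets \<rho> \<and> hd \<rho> = s0 \<and> last \<rho> = s \<and>
    partial_run gadgets \<rho>' \<and> hd \<rho>' = s0 \<and> last \<rho>' = s"
  then have "length \<rho> > 0" "length \<rho>' > 0"
    by (auto simp: partial_run_def)
  moreover have "length \<rho> - 1 = length \<rho>' - 1"
    using time_partial_run[of \<rho>] time_partial_run[of \<rho>'] a by simp
  ultimately show "length \<rho> = length \<rho>'"
    by linarith
qed

lemma pmf_probs_rat: "pmf (probs gadgets s) s' \<in> \<rat>"
proof (cases "\<exists>d. s' = state (Suc (time s)) d")
  case True
  then obtain d where "s' = state (Suc (time s)) d" ..
  then show ?thesis
    by (simp add: gadgets_def pmf_map_inj' inj_def pmf_tag_law_rat)
next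
  case False
  then have "s' \<notin> set_pmf (probs gadgets s)"
    by (auto simp: gadgets_def)
  then show ?thesis
    by (simp add: set_pmf_iff)
qed

lemma reward_gadgets: "reward gadgets e \<in> {-1, 0, 1}"
  by (auto simp: gadgets_def tag_reward_def split: prod.split)

lemma run_gadgets:
  assumes "\<omega> \<in> runs gadgets" "\<omega> 0 = initial"
  shows "time (\<omega> t) = t" "tag_path (\<lambda>t. tag (\<omega> t))"
    "(\<Sum>j<t. reward gadgets (\<omega> j, \<omega> (Suc j))) = payoff (\<lambda>t. tag (\<omega> t)) t"
proof -
  have r: "(\<omega> t, \<omega> (Suc t)) \<in> transitions gadgets" for t
    using assms(1) by (simp add: runs_def)
  show time: "time (\<omega> t) = t" for t
    by (induction t) (use r assms(2) in \<open>auto simp: initial_def in_transitions\<close>)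
  show "tag_path (\<lambda>t. tag (\<omega> t))"
    using r assms(2) by (auto simp: tag_path_def in_transitions time initial_def)
  show "(\<Sum>j<t. reward gadgets (\<omega> j, \<omega> (Suc j))) = payoff (\<lambda>t. tag (\<omega> t)) t"
    by (simp add: gadgets_def payoff_def time)
qed

lemma TP_liminf_gadgets:
  assumes "\<omega> 0 = initial"
  shows "\<omega> \<in> TP_liminf_ge_0 gadgets \<longleftrightarrow>
    \<omega> \<in> runs gadgets \<and> 0 \<le> liminf (\<lambda>t. ereal (payoff (\<lambda>t. tag (\<omega> t)) t))"
  using run_gadgets(3)[of \<omega>] assms by (auto simp: TP_liminf_ge_0_def)

section \<open>The two series over all gadgets\<close>

lemma half_pow_mult_nat: "(1 / 2) ^ k * real k \<le> 1 / 2" 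
proof (cases k)
  case (Suc j)
  have "Suc j \<le> 2 ^ j"
    using less_exp[of j] by (simp add: Suc_le_eq)
  then have "real (Suc j) \<le> 2 ^ j"
    by (metis of_nat_le_iff of_nat_numeral of_nat_power)
  then show ?thesis
    by (simp add: Suc field_simps)
qed simp

lemma sum_level:
  fixes f :: "nat \<Rightarrow> real"
  shows "(\<Sum>n<level_start k. f (level n)) = (\<Sum>l<k. 2 ^ (l * l) * f l)"
proof (induction k)
  case (Suc k)
  have le: "level_start k \<le> level_start (Suc k)"
    by (simp add: level_start_def)
  have "{..<level_start (Suc k)} = {..<level_start k} \<union> {level_start k..<level_start (Suc k)}"
    using le by auto
  then have "(\<Sum>n<level_start (Suc k). f (level n)) =
      (\<Sum>n<level_start k. f (level n)) + (\<Sum>n\<in>{level_start k..<level_start (Suc k)}. f (level n))"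
    by (simp add: sum.union_disjoint ivl_disj_int)
  also have "(\<Sum>n\<in>{level_start k..<level_start (Suc k)}. f (level n)) =
      (\<Sum>n\<in>{level_start k..<level_start (Suc k)}. f k)"
    by (rule sum.cong) (auto simp: level_eq)
  finally show ?case
    by (simp add: Suc) (simp add: level_start_def)
qed (simp add: level_start_def)

text \<open>Level \<open>l\<close> contributes exactly 1, by \<open>2^(l^2)\<close> gadgets with the
  term \<open>(2^-l)^l\<close> each.\<close>

lemma not_summable_ratio: "\<not> summable (\<lambda>n. ratio n ^ level n)"
proof
  assume s: "summable (\<lambda>n. ratio n ^ level n)"
  have "real k \<le> (\<Sum>n. ratio n ^ level n)" for k
  proof -
    have "(\<Sum>n<level_start k. ratio n ^ level n) = (\<Sum>l<k. 2 ^ (l * l) * ((1 / 2) ^ l) ^ l)"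
      using sum_level[of "\<lambda>l. ((1 / 2) ^ l) ^ l" k] by (simp add: ratio_def)
    also have "\<dots> = (\<Sum>l<k. 1)"
      by (rule sum.cong) (auto simp: power_mult[symmetric] power_mult_distrib[symmetric])
    finally have "real k = (\<Sum>n<level_start k. ratio n ^ level n)"
      by simp
    also have "\<dots> \<le> (\<Sum>n. ratio n ^ level n)"
      by (rule sum_le_suminf[OF s]) (auto simp: ratio_def)
    finally show ?thesis .
  qed
  then show False
    using reals_Archimedean2[of "\<Sum>n. ratio n ^ level n"] by (meson not_le)
qed

text \<open>The one additional factor \<open>ratio n\<close> turns the contribution of level
  \<open>l\<close> into \<open>l * 2^-l\<close>.\<close>

lemma summable_ratio: "summable (\<lambda>n. real (level n) * ratio n ^ Suc (level n))"
proof (rule summableI_nonneg_bounded)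
  have s: "summable (\<lambda>l. real l * (1 / 2) ^ l :: real)"
  proof (rule summable_ratio_test[where c = "3 / 4" and N = 2])
    \<comment> \<open>The quotient of consecutive terms is \<open>(l + 1) / (2 * l)\<close>, which
      is at most 3/4 from \<open>l = 2\<close> on.\<close>
    fix l :: nat assume "2 \<le> l"
    then show "norm (real (Suc l) * (1 / 2) ^ Suc l :: real) \<le> 3 / 4 * norm (real l * (1 / 2) ^ l :: real)"
      by (simp add: field_simps)
  qed simp
  show "(\<Sum>n<N. real (level n) * ratio n ^ Suc (level n)) \<le> (\<Sum>l. real l * (1 / 2) ^ l)" for N
  proof -
    \<comment> \<open>Filling up to complete levels is possible since
      \<open>N \<le> level_start N\<close>.\<close>
    have "(\<Sum>n<N. real (level n) * ratio n ^ Suc (level n)) \<le> (\<Sum>n<level_start N. real (level n) * ratio n ^ Suc (level n))"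
      using strict_mono_imp_increasing[OF strict_mono_level_start, of N]
      by (intro sum_mono2) (auto simp: ratio_def)
    also have "\<dots> = (\<Sum>l<N. 2 ^ (l * l) * (real l * ((1 / 2) ^ l) ^ Suc l))"
      using sum_level[of "\<lambda>l. real l * ((1 / 2) ^ l) ^ Suc l" N] by (simp add: ratio_def)
    also have "\<dots> = (\<Sum>l<N. real l * (1 / 2) ^ l)"
    proof (rule sum.cong)
      fix l
      have "2 ^ (l * l) * ((1 / 2) ^ l) ^ l = (1::real)"
        by (simp add: power_mult[symmetric] power_mult_distrib[symmetric])
      then show "2 ^ (l * l) * (real l * ((1 / 2) ^ l) ^ Suc l) = real l * (1 / 2) ^ l"
        by (simp add: algebra_simps)
    qed simp
    also have "\<dots> \<le> (\<Sum>l. real l * (1 / 2) ^ l)"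
      by (rule sum_le_suminf[OF s]) auto
    finally show ?thesis .
  qed
qed (auto simp: ratio_def)


section \<open>Strategies of value close to one\<close>

lemma tag_path_half_start:
  assumes d: "tag_path d"
  shows "d (half_start n h) \<le> 1"
proof -
  have *: "d (half_start n h + half_length n) \<le> 1" if le: "d (half_start n h) \<le> 1" for n h
  proof (cases "d (half_start n h) = 0")
    case True
    then show ?thesis using lost_absorbing(1)[OF d True] by simp
  next
    case False
    with le have "d (half_start n h) = 1" by simp
    then interpret half_path n h "\<lambda>i. d (half_start n h + i)"
      by (rule half_path_tag_path[OF d])
    show ?thesis using merge by simp
  qed
  have "d (gadget_start n) \<le> 1" for n
  proof (induction n)
    case 0
    then show ?case using d by (simp add: tag_path_def)
  next
    case (Suc n)
    then show ?case using *[of n False] *[of n True] by (simp add: half_start_add)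
  qed
  then show ?thesis
    using *[of n False] by (cases h) (auto simp: half_start_add)
qed

lemma tag_path_half_path:
  assumes d: "tag_path d" and "d (half_start n h + i) \<noteq> 0"
  shows "half_path n h (\<lambda>i. d (half_start n h + i))"
proof -
  have "d (half_start n h) \<noteq> 0"
    using lost_absorbing(1)[OF d, of "half_start n h" i] assms(2) by auto
  then have "d (half_start n h) = 1"
    using tag_path_half_start[OF d, of n h] by simp
  then show ?thesis by (rule half_path_tag_path[OF d])
qed

text \<open>The tag 0 can be entered only at the risk step of a player's half, so the first time
  with tag 0 identifies the gadget of the loss.\<close>

lemma lost_at_risk:
  assumes d: "tag_path d" and "d t = 0"
  shows "\<exists>n. d (half_start n True + level n) \<noteq> 0 \<and> d (Suc (half_start n True + level n)) = 0"
proof -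
  define t' where "t' = (LEAST t. d t = 0)"
  have t': "d t' = 0" unfolding t'_def by (rule LeastI[of _ t]) (rule assms)
  have "t' \<noteq> 0" using t' d by (intro notI) (simp add: tag_path_def)
  then obtain u where u: "t' = Suc u" by (cases t') auto
  have nu: "d u \<noteq> 0" using not_less_Least[of u "\<lambda>t. d t = 0"] u by (simp add: t'_def)
  obtain n h i where ni: "u = half_start n h + i" "i < half_length n" by (rule time_cases)
  have "d (Suc u) \<in> next_tags n h i (d u)"
    using d[unfolded tag_path_def, THEN conjunct2, rule_format, of u] phase[OF ni(2)] ni(1) by simp
  then have "0 \<in> next_tags n h i (d u)" using t' u by simp
  then have "i = level n \<and> h" using nu by (auto simp: next_tags_def split: if_splits)
  then show ?thesis using nu t' ni u by auto
qed

text \<open>For \<open>i = 0\<close> the difference \<open>i - 1\<close> is 0 and gadget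
  \<open>n0\<close> brings no surplus; that event is bounded separately.\<close>

definition choice :: "nat \<Rightarrow> nat \<Rightarrow> nat \<Rightarrow> nat" where
  "choice n0 n i = (if n < n0 then level n else if n = n0 then i - 1 else i)"

text \<open>
  The index \<open>gadget_start n + level n\<close> is the time at which nature's counter is complete.
\<close>

definition good_strategy :: "nat \<Rightarrow> nat list \<Rightarrow> nat pmf" where
  "good_strategy n0 \<rho> =
     (let t = time (last \<rho>); n = gadget t; d = tag (last \<rho>);
          c = choice n0 n (tag (\<rho> ! (gadget_start n + level n)) - 1)
      in return_pmf (state (Suc t) (if offset t < c then Suc d else d)))"

lemma good_strategy_successor:
  "last \<rho> \<in> controlled gadgets \<Longrightarrow> set_pmf (good_strategy n0 \<rho>) \<subseteq> successors gadgets (last \<rho>)"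
  unfolding good_strategy_def Let_def
  by (auto simp: in_successors in_transitions next_tags_def) (auto simp: gadgets_def)

lemma good_strategy_strategies: "good_strategy n0 \<in> strategies gadgets"
  using good_strategy_successor by (auto simp: strategies_def)

lemma next_state_good: "set_pmf (next_state gadgets (good_strategy n0) \<rho>) \<subseteq> successors gadgets (last \<rho>)"
  using good_strategy_successor[of \<rho> n0] countable_mdp_gadgets
  by (auto simp: next_state_def countable_mdp_def random_states_def)

section \<open>Risk of the good strategy\<close>

context
  fixes n0 :: nat
begin

abbreviation "good_runs \<equiv> run_measure gadgets initial (good_strategy n0)"

interpretation R: prob_space good_runs
  by (rule prob_space_run_measure)

lemma sets_coordinate: "{\<omega>. P (\<omega> t)} \<in> R.events"
proof -
  have "{\<omega>. P (\<omega> t)} = {\<omega>. (\<lambda>\<rho>. P (\<rho> ! t)) (map \<omega> [0..<Suc t])}"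
    by (simp add: nth_append)
  then show ?thesis
    using sets_prefix[of "\<lambda>\<rho>. P (\<rho> ! t)" "Suc t"] by metis
qed

lemma sets_coordinate2: "{\<omega>. P (\<omega> t) \<and> Q (\<omega> u)} \<in> R.events"
  using sets.Int[OF sets_coordinate[of P t] sets_coordinate[of Q u]] by (simp add: Collect_conj_eq)

lemma AE_good:
  "AE \<omega> in good_runs. \<omega> \<in> runs gadgets \<and> \<omega> 0 = initial \<and>
     (\<forall>t. \<omega> (Suc t) \<in> set_pmf (next_state gadgets (good_strategy n0) (map \<omega> [0..<Suc t])))"
  using AE_start[where M = gadgets and ?s0.0 = initial and \<sigma> = "good_strategy n0"]
    AE_next_state[where M = gadgets and ?s0.0 = initial and \<sigma> = "good_strategy n0"]
proof eventually_elim
  case (elim \<omega>)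
  have "(\<omega> t, \<omega> (Suc t)) \<in> transitions gadgets" for t
    using elim(2)[rule_format, of t] next_state_good[of n0 "map \<omega> [0..<Suc t]"]
    by (auto simp: in_successors)
  then show ?case using elim by (simp add: runs_def)
qed

text \<open>Not being lost is assumed only at the end of the player's choice: the lemma has to
  describe also the runs that are lost at the very next step.\<close>

lemma good_choice:
  fixes \<omega> :: "nat \<Rightarrow> nat"
  defines "d \<equiv> \<lambda>t. tag (\<omega> t)"
  assumes run: "\<omega> \<in> runs gadgets" "\<omega> 0 = initial"
    and follows: "\<And>t. \<omega> (Suc t) \<in> set_pmf (next_state gadgets (good_strategy n0) (map \<omega> [0..<Suc t]))"
    and nz: "d (half_start n True + level n) \<noteq> 0"
  shows "counter d n True = choice n0 n (counter d n False)"
    and "d (gadget_start n + level n) = Suc (counter d n False)"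
    and "d (half_start n True + level n) = Suc (counter d n True)"
    and "counter d n False \<le> level n"
proof -
  have path: "tag_path d" and time: "time (\<omega> t) = t" for t
    using run_gadgets[OF run] by (simp_all add: d_def)
  have st: "\<omega> t = state t (d t)" for t
    using state_time_tag[of "\<omega> t"] by (simp add: time d_def)
  interpret B: half_path n True "\<lambda>i. d (half_start n True + i)"
    by (rule tag_path_half_path[OF path nz])
  have "d (half_start n True) = d (gadget_start n + level n + (half_length n - level n))"
    using half_length_gt[of n] by (simp add: half_start_def)
  then have nz': "d (gadget_start n + level n) \<noteq> 0"
    using lost_absorbing(1)[OF path, of "gadget_start n + level n" "half_length n - level n"] B.start
    by auto
  interpret A: half_path n False "\<lambda>i. d (half_start n False + i)"
    by (rule tag_path_half_path[OF path, of _ _ "level n"]) (use nz' in simp)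
  show le: "counter d n False \<le> level n"
    using A.choice_le by (simp add: counter_def)
  show "d (gadget_start n + level n) = Suc (counter d n False)"
    using nz' by (simp add: counter_def)
  show "d (half_start n True + level n) = Suc (counter d n True)"
    using nz by (simp add: counter_def)
  let ?c = "choice n0 n (counter d n False)"
  have cl: "?c \<le> level n"
    using le by (auto simp: choice_def)
  \<comment> \<open>The player's counter follows the offset up to the target \<open>?c\<close> and
    is frozen afterwards. During the choice, the state is controlled exactly as long as the offset
    does not exceed \<open>?c\<close>.\<close>
  have "d (half_start n True + i) = Suc (min i ?c)" if "i \<le> level n" for i
    using that
  proof (induction i)
    case 0
    then show ?case using B.start by simp
  next
    case (Suc i)
    let ?t = "half_start n True + i"
    have IH: "d ?t = Suc (min i ?c)" and i: "i < level n" "i < half_length n"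
      using Suc half_length_gt[of n] by auto
    show ?case
    proof (cases "i \<le> ?c")
      case True
      then have dt: "d ?t = Suc i" using IH by simp
      have last: "last (map \<omega> [0..<Suc ?t]) = state ?t (Suc i)"
        using st[of ?t] dt by simp
      have idx: "gadget_start n + level n < Suc ?t"
        using half_length_gt[of n] by (simp add: half_start_def)
      have "state ?t (Suc i) \<in> controlled gadgets"
        using i by (simp add: in_controlled)
      then have "next_state gadgets (good_strategy n0) (map \<omega> [0..<Suc ?t]) =
          return_pmf (state (Suc ?t) (if i < ?c then Suc (Suc i) else Suc i))"
        unfolding next_state_def last good_strategy_def Let_def
        using i idx by (simp add: d_def counter_def nth_append del: upt_Suc)
      then have "d (Suc ?t) = (if i < ?c then Suc (Suc i) else Suc i)"
        using follows[of ?t] by (simp add: d_def del: upt_Suc)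
      then show ?thesis using True by auto
    next
      case False
      then show ?thesis
        using B.step[OF i(2)] IH i(1) by (simp add: next_tags_def)
    qed
  qed
  from this[of "level n"] show "counter d n True = ?c"
    using cl by (simp add: counter_def)
qed

text \<open>A final counter \<open>i < level n\<close> means that nature stopped at offset
  \<open>i\<close>, a single step of conditional probability \<open>ratio n ^ (level n - i)\<close>;
  the probability of arriving there is bounded by 1.\<close>

lemma prob_counter_le:
  assumes "i \<le> level n"
  shows "R.prob {\<omega>. tag (\<omega> (gadget_start n + level n)) = Suc i} \<le> ratio n ^ (level n - i)"
proof (cases "i = level n")
  case False
  then have i: "i < level n" "i < half_length n"
    using assms half_length_gt[of n] by auto
  let ?t = "half_start n False + i"
  have "R.prob {\<omega>. tag (\<omega> (gadget_start n + level n)) = Suc i} \<le>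
    R.prob {\<omega>. \<omega> ?t = state ?t (Suc i) \<and> \<omega> (Suc ?t) \<in> {s. tag s = Suc i}}"
  proof (rule R.finite_measure_mono_AE)
    show "AE \<omega> in good_runs. \<omega> \<in> {\<omega>. tag (\<omega> (gadget_start n + level n)) = Suc i} \<longrightarrow>
        \<omega> \<in> {\<omega>. \<omega> ?t = state ?t (Suc i) \<and> \<omega> (Suc ?t) \<in> {s. tag s = Suc i}}"
      using AE_good
    proof eventually_elim
      case (elim \<omega>)
      let ?d = "\<lambda>t. tag (\<omega> t)"
      note path = run_gadgets(1,2)[of \<omega>]
      show ?case
      proof
        assume "\<omega> \<in> {\<omega>. tag (\<omega> (gadget_start n + level n)) = Suc i}"
        then have e: "?d (half_start n False + level n) = Suc i" by simp
        interpret half_path n False "\<lambda>i. ?d (half_start n False + i)"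
          by (rule tag_path_half_path[of ?d _ _ "level n"]) (use path elim e in auto)
        have "?d ?t = Suc i" "?d (half_start n False + Suc i) = Suc i"
          using choose_min[of i "level n"] choose_min[of "Suc i" "level n"] e i by simp_all
        then show "\<omega> \<in> {\<omega>. \<omega> ?t = state ?t (Suc i) \<and> \<omega> (Suc ?t) \<in> {s. tag s = Suc i}}"
          using state_time_tag[of "\<omega> ?t"] path(1)[of ?t] elim by simp
      qed
    qed
  qed (rule sets_coordinate2)
  also have "\<dots> = R.prob {\<omega>. (\<lambda>\<rho>. last \<rho> = state ?t (Suc i)) (map \<omega> [0..<Suc ?t]) \<and> \<omega> (Suc ?t) \<in> {s. tag s = Suc i}}"
    by simp
  also have "\<dots> \<le> ratio n ^ (level n - i) * R.prob {\<omega>. (\<lambda>\<rho>. last \<rho> = state ?t (Suc i)) (map \<omega> [0..<Suc ?t])}"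
  proof (rule run_measure_step_le)
    fix \<rho> :: "nat list" assume \<rho>: "last \<rho> = state ?t (Suc i)"
    have "state ?t (Suc i) \<notin> controlled gadgets"
      using in_controlled[OF i(2), of False] by simp
    then have "next_state gadgets (good_strategy n0) \<rho> = map_pmf (state (Suc ?t)) (tag_law n False i (Suc i))"
      unfolding next_state_def \<rho> using probs_gadgets[OF i(2), of False] by simp
    then have "measure_pmf.prob (next_state gadgets (good_strategy n0) \<rho>) {s. tag s = Suc i} =
        pmf (tag_law n False i (Suc i)) (Suc i)"
      by (simp add: vimage_def measure_pmf_single)
    then show "measure_pmf.prob (next_state gadgets (good_strategy n0) \<rho>) {s. tag s = Suc i} \<le> ratio n ^ (level n - i)"
      using i by (simp add: tag_law_def pmf_mix ratio_power_le_one ratio_bounds less_imp_le)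
  qed (simp add: ratio_bounds less_imp_le)
  also have "\<dots> \<le> ratio n ^ (level n - i) * 1"
    by (intro mult_left_mono) (auto simp: ratio_bounds less_imp_le)
  finally show ?thesis by simp
qed simp

text \<open>Nature's counter is kept in the event so that its own small probability can multiply the
  risk; the risk alone would be too large to be summed over all gadgets.\<close>

lemma prob_loss_step_le:
  assumes c: "c < level n"
  shows "R.prob {\<omega>. (tag (\<omega> (gadget_start n + level n)) = Suc i \<and>
      \<omega> (half_start n True + level n) = state (half_start n True + level n) (Suc c)) \<and>
      tag (\<omega> (Suc (half_start n True + level n))) = 0}
    \<le> ratio n ^ Suc c * R.prob {\<omega>. tag (\<omega> (gadget_start n + level n)) = Suc i}"
proof -
  let ?t = "half_start n True + level n" and ?a = "gadget_start n + level n"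
  have l: "level n < half_length n"
    using half_length_gt[of n] by simp
  have a: "?a < Suc ?t"
    using l by (simp add: half_start_def)
  let ?A = "\<lambda>\<rho>. tag (\<rho> ! ?a) = Suc i \<and> last \<rho> = state ?t (Suc c)"
  have A: "?A (map \<omega> [0..<Suc ?t]) \<longleftrightarrow> tag (\<omega> ?a) = Suc i \<and> \<omega> ?t = state ?t (Suc c)" for \<omega>
    using a by (auto simp del: upt_Suc) (simp_all add: last_map)
  have "R.prob {\<omega>. ?A (map \<omega> [0..<Suc ?t]) \<and> \<omega> (Suc ?t) \<in> {s. tag s = 0}} \<le> 
    ratio n ^ Suc c * R.prob {\<omega>. ?A (map \<omega> [0..<Suc ?t])}"
  proof (rule run_measure_step_le)
    fix \<rho> assume \<rho>: "?A \<rho>"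
    have "state ?t (Suc c) \<notin> controlled gadgets"
      using in_controlled[OF l] by simp
    then have "next_state gadgets (good_strategy n0) \<rho> = map_pmf (state (Suc ?t)) (tag_law n True (level n) (Suc c))"
      unfolding next_state_def using \<rho> probs_gadgets[OF l, of True] by simp
    then have "measure_pmf.prob (next_state gadgets (good_strategy n0) \<rho>) {s. tag s = 0} =
        pmf (tag_law n True (level n) (Suc c)) 0"
      by (simp add: vimage_def measure_pmf_single)
    then show "measure_pmf.prob (next_state gadgets (good_strategy n0) \<rho>) {s. tag s = 0} \<le> ratio n ^ Suc c"
      using c ratio_power_le_one[of n "Suc c"] ratio_bounds[of n] by (simp add: tag_law_def pmf_mix)
  qed (simp add: ratio_bounds less_imp_le)
  also have "\<dots> \<le> ratio n ^ Suc c * R.prob {\<omega>. tag (\<omega> ?a) = Suc i}"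
  proof (intro mult_left_mono R.finite_measure_mono)
    show "{\<omega>. ?A (map \<omega> [0..<Suc ?t])} \<subseteq> {\<omega>. tag (\<omega> ?a) = Suc i}"
      unfolding A by auto
  qed (use sets_coordinate[of "\<lambda>s. tag s = Suc i"] ratio_bounds[of n] in auto)
  finally show ?thesis
    unfolding A by simp
qed

text \<open>A union over nature's counter \<open>i\<close>. Values that are answered by
  \<open>level n\<close> drop out, as a full counter runs no risk.\<close>

lemma prob_loss_le:
  "R.prob {\<omega>. tag (\<omega> (half_start n True + level n)) \<noteq> 0 \<and> tag (\<omega> (Suc (half_start n True + level n))) = 0}
    \<le> (\<Sum>i | i \<le> level n \<and> choice n0 n i < level n. ratio n ^ (Suc (choice n0 n i) + (level n - i)))"
proof -
  let ?t = "half_start n True + level n" and ?a = "gadget_start n + level n"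
  let ?I = "{i. i \<le> level n \<and> choice n0 n i < level n}"
  let ?E = "\<lambda>i. {\<omega>. (tag (\<omega> ?a) = Suc i \<and> \<omega> ?t = state ?t (Suc (choice n0 n i))) \<and> tag (\<omega> (Suc ?t)) = 0}"
  have E: "?E i \<in> R.events" for i
    using sets.Int[OF sets_coordinate2[of "\<lambda>s. tag s = Suc i" ?a "\<lambda>s. s = state ?t (Suc (choice n0 n i))" ?t]
        sets_coordinate[of "\<lambda>s. tag s = 0" "Suc ?t"]]
    by (simp add: Collect_conj_eq)
  have fin: "finite ?I" by simp
  have "R.prob {\<omega>. tag (\<omega> ?t) \<noteq> 0 \<and> tag (\<omega> (Suc ?t)) = 0} \<le> R.prob (\<Union>i\<in>?I. ?E i)"
  proof (rule R.finite_measure_mono_AE)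
    show "AE \<omega> in good_runs. \<omega> \<in> {\<omega>. tag (\<omega> ?t) \<noteq> 0 \<and> tag (\<omega> (Suc ?t)) = 0} \<longrightarrow> \<omega> \<in> (\<Union>i\<in>?I. ?E i)"
      using AE_good
    proof eventually_elim
      case (elim \<omega>)
      let ?d = "\<lambda>t. tag (\<omega> t)"
      show ?case
      proof
        assume "\<omega> \<in> {\<omega>. tag (\<omega> ?t) \<noteq> 0 \<and> tag (\<omega> (Suc ?t)) = 0}"
        then have nz: "?d ?t \<noteq> 0" and z: "?d (Suc ?t) = 0" by auto
        note g = good_choice[of \<omega> n, OF _ _ _ nz]
        have run: "\<omega> \<in> runs gadgets" "\<omega> 0 = initial" using elim by auto
        interpret half_path n True "\<lambda>i. ?d (half_start n True + i)"
          by (rule tag_path_half_path[OF run_gadgets(2)[OF run] nz])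
        let ?i = "counter ?d n False"
        have c: "counter ?d n True = choice n0 n ?i" "?d ?a = Suc ?i" "?d ?t = Suc (choice n0 n ?i)" "?i \<le> level n"
          using g elim by metis+
        moreover have "choice n0 n ?i < level n"
          using risk z nz c(3) by auto
        moreover have "\<omega> ?t = state ?t (Suc (choice n0 n ?i))"
          using state_time_tag[of "\<omega> ?t"] run_gadgets(1)[OF run, of ?t] c(3) by simp
        ultimately show "\<omega> \<in> (\<Union>i\<in>?I. ?E i)"
          using z by blast
      qed
    qed
    show "(\<Union>i\<in>?I. ?E i) \<in> R.events"
      using E fin by (intro sets.finite_UN) auto
  qed
  also have "\<dots> \<le> (\<Sum>i\<in>?I. R.prob (?E i))"
    using E fin by (intro R.finite_measure_subadditive_finite) auto
  also have "\<dots> \<le> (\<Sum>i\<in>?I. ratio n ^ (Suc (choice n0 n i) + (level n - i)))"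
  proof (rule sum_mono)
    fix i assume i: "i \<in> ?I"
    then have "R.prob (?E i) \<le> ratio n ^ Suc (choice n0 n i) * R.prob {\<omega>. tag (\<omega> ?a) = Suc i}"
      by (intro prob_loss_step_le) auto
    also have "\<dots> \<le> ratio n ^ Suc (choice n0 n i) * ratio n ^ (level n - i)"
      using i ratio_bounds[of n] by (intro mult_left_mono prob_counter_le) auto
    finally show "R.prob (?E i) \<le> ratio n ^ (Suc (choice n0 n i) + (level n - i))"
      by (simp only: power_add)
  qed
  finally show ?thesis .
qed

text \<open>Before \<open>n0\<close> the index set is empty. At \<open>n0\<close> every exponent is
  at least \<open>level n\<close>. After \<open>n0\<close> all exponents are
  \<open>Suc (level n)\<close>, and \<open>i = level n\<close> drops out. The two conditionals are
  kept apart so that summing over \<open>n\<close> gives one term plus the tail of a convergent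
  series.\<close>

lemma loss_bound:
  "(\<Sum>i | i \<le> level n \<and> choice n0 n i < level n. ratio n ^ (Suc (choice n0 n i) + (level n - i)))
   \<le> (if n = n0 then real (Suc (level n0)) * ratio n0 ^ level n0 else 0) +
     (if n < n0 then 0 else real (level n) * ratio n ^ Suc (level n))" (is "sum ?f ?I \<le> _")
proof -
  have r: "0 \<le> ratio n" "ratio n \<le> 1" using ratio_bounds[of n] by auto
  consider "n < n0" | "n = n0" | "n0 < n" by linarith
  then show ?thesis
  proof cases
    case 1
    then show ?thesis by (simp add: choice_def)
  next
    case 2
    have "sum ?f ?I \<le> sum ?f {..level n}"
      using r by (intro sum_mono2) auto
    also have "\<dots> \<le> (\<Sum>i\<in>{..level n}. ratio n ^ level n)"
      using 2 r by (intro sum_mono power_decreasing) (auto simp: choice_def)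
    finally show ?thesis
      using 2 r by (simp add: add_increasing2)
  next
    case 3
    have "sum ?f ?I = (\<Sum>i\<in>{..<level n}. ratio n ^ Suc (level n))"
      using 3 by (intro sum.cong) (auto simp: choice_def)
    then show ?thesis
      using 3 by simp
  qed
qed

text \<open>Almost surely the run wins unless nature's counter in gadget \<open>n0\<close> is 0 or
  some risk step loses. The three terms bound that zero, the loss in gadget \<open>n0\<close> and
  the losses after it.\<close>

lemma prob_good_ge:
  "R.prob (TP_liminf_ge_0 gadgets) \<ge> 1 - (ratio n0 ^ level n0 + real (Suc (level n0)) * ratio n0 ^ level n0 +
    (\<Sum>n. real (level (n + n0)) * ratio (n + n0) ^ Suc (level (n + n0))))"
proof -
  let ?L = "\<lambda>n. {\<omega>. tag (\<omega> (half_start n True + level n)) \<noteq> 0 \<and> tag (\<omega> (Suc (half_start n True + level n))) = 0}"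
  let ?Z = "{\<omega>. tag (\<omega> (gadget_start n0 + level n0)) = Suc 0}"
  let ?a = "\<lambda>n. real (level n) * ratio n ^ Suc (level n)"
  let ?b = "\<lambda>n. if n = n0 then real (Suc (level n0)) * ratio n0 ^ level n0 else 0"
  let ?c = "\<lambda>n. if n < n0 then 0 else ?a n"
  have L: "?L n \<in> R.events" for n
    using sets_coordinate2[of "\<lambda>s. tag s \<noteq> 0" "half_start n True + level n" "\<lambda>s. tag s = 0"] .
  have Z: "?Z \<in> R.events"
    using sets_coordinate[of "\<lambda>s. tag s = Suc 0"] .
  have le: "R.prob (?L n) \<le> ?b n + ?c n" for n
    by (rule order_trans[OF prob_loss_le loss_bound])
  have sb: "?b sums (real (Suc (level n0)) * ratio n0 ^ level n0)"
    using sums_single[of n0 "\<lambda>_. real (Suc (level n0)) * ratio n0 ^ level n0"] by simp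
  have sc: "?c sums (\<Sum>n. ?a (n + n0))"
  proof -
    have "(\<lambda>n. ?c (n + n0)) sums (\<Sum>n. ?a (n + n0))"
      using summable_ignore_initial_segment[OF summable_ratio, of n0] by (simp add: summable_sums)
    then have "?c sums ((\<Sum>n. ?a (n + n0)) + sum ?c {..<n0})"
      by (subst (asm) sums_iff_shift)
    then show ?thesis by simp
  qed
  have sbc: "(\<lambda>n. ?b n + ?c n) sums (real (Suc (level n0)) * ratio n0 ^ level n0 + (\<Sum>n. ?a (n + n0)))"
    using sums_add[OF sb sc] .
  have sL: "summable (\<lambda>n. R.prob (?L n))"
    by (rule summable_comparison_test'[OF sums_summable[OF sbc], of 0]) (use le in simp)
  have "R.prob (\<Union>n. ?L n) \<le> (\<Sum>n. R.prob (?L n))"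
    by (rule R.finite_measure_subadditive_countably) (use L sL in auto)
  also have "\<dots> \<le> (\<Sum>n. ?b n + ?c n)"
    by (rule suminf_le[OF le sL sums_summable[OF sbc]])
  finally have UL: "R.prob (\<Union>n. ?L n) \<le> real (Suc (level n0)) * ratio n0 ^ level n0 + (\<Sum>n. ?a (n + n0))"
    using sums_unique[OF sbc] by simp
  have PZ: "R.prob ?Z \<le> ratio n0 ^ level n0"
    using prob_counter_le[of 0 n0] by simp
  have W: "TP_liminf_ge_0 gadgets \<in> R.events"
    by (rule sets_TP_liminf_ge_0)
  have "1 = R.prob (TP_liminf_ge_0 gadgets \<union> (?Z \<union> (\<Union>n. ?L n)))"
  proof (rule R.prob_eq_1[THEN iffD2, symmetric])
    show "AE \<omega> in good_runs. \<omega> \<in> TP_liminf_ge_0 gadgets \<union> (?Z \<union> (\<Union>n. ?L n))"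
      using AE_good
    proof eventually_elim
      case (elim \<omega>)
      let ?d = "\<lambda>t. tag (\<omega> t)"
      have run: "\<omega> \<in> runs gadgets" "\<omega> 0 = initial" using elim by auto
      note path = run_gadgets(2)[OF run]
      show ?case
      proof (rule ccontr)
        assume *: "\<omega> \<notin> TP_liminf_ge_0 gadgets \<union> (?Z \<union> (\<Union>n. ?L n))"
        then have nL: "\<not> (?d (half_start n True + level n) \<noteq> 0 \<and> ?d (Suc (half_start n True + level n)) = 0)" for n
          by blast
        have pos: "?d t \<noteq> 0" for t
          using lost_at_risk[OF path, of t] nL by blast
        have g: "counter ?d n True = choice n0 n (counter ?d n False)" "?d (gadget_start n + level n) = Suc (counter ?d n False)" for n
          using good_choice[of \<omega> n] elim pos by metis+
        have "?d (gadget_start n0 + level n0) \<noteq> Suc 0"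
          using * by blast
        then have "counter ?d n0 True < counter ?d n0 False"
          using g(2)[of n0] by (simp add: g(1) choice_def)
        moreover have "counter ?d n True \<le> counter ?d n False" if "n0 < n" for n
          using that by (simp add: g(1) choice_def)
        ultimately have "0 \<le> liminf (\<lambda>t. ereal (payoff ?d t))"
          using good_path_wins[OF path pos] by blast
        then have "\<omega> \<in> TP_liminf_ge_0 gadgets"
          using TP_liminf_gadgets[of \<omega>] run by blast
        then show False using * by blast
      qed
    qed
    show "TP_liminf_ge_0 gadgets \<union> (?Z \<union> (\<Union>n. ?L n)) \<in> R.events"
      using W Z L by (intro sets.Un sets.countable_UN) auto
  qed
  also have "\<dots> \<le> R.prob (TP_liminf_ge_0 gadgets) + R.prob (?Z \<union> (\<Union>n. ?L n))"
    using W Z L by (intro measure_Un_le sets.Un sets.countable_UN) auto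
  also have "R.prob (?Z \<union> (\<Union>n. ?L n)) \<le> R.prob ?Z + R.prob (\<Union>n. ?L n)"
    using Z L by (intro measure_Un_le sets.countable_UN) auto
  finally show ?thesis
    using UL PZ by linarith
qed

end

lemma value_gadgets: "value_of gadgets initial (TP_liminf_ge_0 gadgets) = 1"
proof -
  let ?f = "\<lambda>\<sigma>. measure (run_measure gadgets initial \<sigma>) (TP_liminf_ge_0 gadgets)"
  have le: "?f \<sigma> \<le> 1" for \<sigma>
    by (rule prob_space.prob_le_1[OF prob_space_run_measure])
  have bdd: "bdd_above (?f ` strategies gadgets)"
    using le by (intro bdd_aboveI[of _ 1]) auto
  have upper: "value_of gadgets initial (TP_liminf_ge_0 gadgets) \<le> 1"
    unfolding value_of_def using le strategies_nonempty[OF countable_mdp_gadgets]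
    by (intro cSUP_least) auto
  have lower: "1 - \<epsilon> \<le> value_of gadgets initial (TP_liminf_ge_0 gadgets)" if "\<epsilon> > 0" for \<epsilon>
  proof -
    let ?a = "\<lambda>n. real (level n) * ratio n ^ Suc (level n)"
    \<comment> \<open>This is \<open>(k + 2) * 2^-k\<close>. For \<open>k = level n0\<close> it
      dominates the sum of the two terms of \<open>prob_good_ge\<close> that concern gadget
      \<open>n0\<close>.\<close>
    let ?g = "\<lambda>k. real k * (1 / 2) ^ k + 2 * (1 / 2) ^ k :: real"
    have "0 < \<epsilon> / 2" using that by simp
    from suminf_exist_split[OF this summable_ratio]
    obtain N where N: "\<And>n. N \<le> n \<Longrightarrow> norm (\<Sum>i. ?a (i + n)) < \<epsilon> / 2"
      by metis
    have "?g \<longlonglongrightarrow> 0 + 2 * 0"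
      by (intro tendsto_add tendsto_mult tendsto_const powser_times_n_limit_0 LIMSEQ_power_zero) auto
    then have "eventually (\<lambda>k. ?g k < \<epsilon> / 2) sequentially"
      using that by (intro order_tendstoD(2)) auto
    then obtain k0 where k0: "\<And>k. k0 \<le> k \<Longrightarrow> ?g k < \<epsilon> / 2"
      by (auto simp: eventually_sequentially)
    \<comment> \<open>\<open>Suc k0\<close> makes the level positive, so that
      \<open>ratio n0 ^ level n0 \<le> ratio n0\<close>.\<close>
    define n0 where "n0 = max (Suc N) (level_start (Suc k0))"
    have l: "Suc k0 \<le> level n0"
      by (rule level_ge) (simp add: n0_def)
    have "ratio n0 ^ level n0 \<le> ratio n0 ^ 1"
      using l ratio_bounds[of n0] by (intro power_decreasing) auto
    then have "real (level n0 + 2) * ratio n0 ^ level n0 \<le> real (level n0 + 2) * (1 / 2) ^ level n0"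
      by (intro mult_left_mono) (auto simp: ratio_def)
    also have "\<dots> < \<epsilon> / 2"
      using k0[of "level n0"] l by (simp add: algebra_simps)
    finally have "ratio n0 ^ level n0 + real (Suc (level n0)) * ratio n0 ^ level n0 < \<epsilon> / 2"
      by (simp add: algebra_simps)
    moreover have "(\<Sum>n. ?a (n + n0)) < \<epsilon> / 2"
    proof -
      have "N \<le> n0" by (simp add: n0_def)
      from N[OF this] show ?thesis
        unfolding real_norm_def by linarith
    qed
    ultimately have "1 - \<epsilon> \<le> ?f (good_strategy n0)"
      using prob_good_ge[of n0] by linarith
    also have "\<dots> \<le> value_of gadgets initial (TP_liminf_ge_0 gadgets)"
      unfolding value_of_def by (rule cSUP_upper[OF good_strategy_strategies bdd])
    finally show ?thesis .
  qed
  have "1 \<le> value_of gadgets initial (TP_liminf_ge_0 gadgets)"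
  proof (rule field_le_epsilon)
    fix \<epsilon> :: real assume "0 < \<epsilon>"
    from lower[OF this] show "1 \<le> value_of gadgets initial (TP_liminf_ge_0 gadgets) + \<epsilon>"
      by linarith
  qed
  with upper show ?thesis by (rule order_antisym)
qed


section \<open>Finite memory\<close>

text \<open>For histories whose clock agrees with the position, the step index
  \<open>length \<rho> - 1\<close> that \<open>mode_extend\<close> hands to \<open>\<tau>\<close>
  can be read off the last state.\<close>

definition consistent :: "nat list \<Rightarrow> bool" where
  "consistent \<rho> \<longleftrightarrow> \<rho> \<noteq> [] \<and> (\<forall>t<length \<rho>. time (\<rho> ! t) = t) \<and>
     (\<forall>t. Suc t < length \<rho> \<longrightarrow> (\<rho> ! t, \<rho> ! Suc t) \<in> transitions gadgets)"

lemma consistent_last: "consistent \<rho> \<Longrightarrow> time (last \<rho>) = length \<rho> - 1"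
  by (simp add: consistent_def last_conv_nth)

lemma consistent_snoc:
  assumes "consistent \<rho>" "(last \<rho>, s) \<in> transitions gadgets"
  shows "consistent (\<rho> @ [s])"
  unfolding consistent_def
proof (intro conjI allI impI)
  have ne: "\<rho> \<noteq> []" using assms(1) by (simp add: consistent_def)
  show "time ((\<rho> @ [s]) ! t) = t" if "t < length (\<rho> @ [s])" for t
    using that assms consistent_last[OF assms(1)] ne
    by (cases "t = length \<rho>") (auto simp: consistent_def nth_append in_transitions)
  show "((\<rho> @ [s]) ! t, (\<rho> @ [s]) ! Suc t) \<in> transitions gadgets" if "Suc t < length (\<rho> @ [s])" for t
  proof (cases "Suc t = length \<rho>")
    case True
    then show ?thesis using assms(2) ne by (simp add: nth_append last_conv_nth True[symmetric])
  next
    case False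
    then show ?thesis using that assms(1) by (auto simp: consistent_def nth_append)
  qed
qed simp

lemma consistent_next_tags:
  assumes "consistent \<rho>" "i < half_length n" "half_start n h + i < length \<rho> - 1"
  shows "tag (\<rho> ! (half_start n h + Suc i)) \<in> next_tags n h i (tag (\<rho> ! (half_start n h + i)))"
proof -
  have "(\<rho> ! (half_start n h + i), \<rho> ! Suc (half_start n h + i)) \<in> transitions gadgets"
    "time (\<rho> ! (half_start n h + i)) = half_start n h + i"
    using assms by (auto simp: consistent_def)
  then show ?thesis
    using assms(2) by (simp add: in_transitions)
qed

text \<open>The last step of the preceding gadget forgets the counter, so only the tags 0 and 1
  remain.\<close>

lemma consistent_tag_le_1:
  assumes "consistent \<rho>" "length \<rho> = Suc (gadget_start n)" "\<rho> ! 0 = initial"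
  shows "tag (last \<rho>) \<le> 1"
proof (cases n)
  case 0
  then have "last \<rho> = initial"
    using assms by (cases \<rho>) auto
  then show ?thesis by (simp add: initial_def)
next
  case (Suc k)
  let ?i = "half_length k - 1"
  have l: "?i < half_length k" "Suc ?i = half_length k" "level k < ?i"
    using half_length_gt[of k] by auto
  have "half_start k True + half_length k = length \<rho> - 1"
    using assms(2) Suc by (simp add: half_start_add)
  then have e: "half_start k True + Suc ?i = length \<rho> - 1" "half_start k True + ?i < length \<rho> - 1"
    using l by linarith+
  have "tag (\<rho> ! (half_start k True + Suc ?i)) \<in> next_tags k True ?i (tag (\<rho> ! (half_start k True + ?i)))"
    by (rule consistent_next_tags[OF assms(1) l(1) e(2)])
  then have "tag (\<rho> ! (length \<rho> - 1)) \<in> next_tags k True ?i (tag (\<rho> ! (half_start k True + ?i)))"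
    unfolding e(1) .
  then have "tag (\<rho> ! (length \<rho> - 1)) \<le> 1"
    using l by (auto simp: next_tags_def split: if_splits)
  then show ?thesis
    using assms(2) by (subst last_conv_nth) auto
qed

lemma gadget_fails_cong:
  assumes "\<And>t. t \<le> gadget_start (Suc n) \<Longrightarrow> d t = d' t"
  shows "gadget_fails d n \<longleftrightarrow> gadget_fails d' n"
proof -
  have "half_start n False + level n \<le> gadget_start (Suc n)" "half_start n True + level n \<le> gadget_start (Suc n)"
    using half_length_gt[of n] by (auto simp: half_start_def gadget_start_Suc)
  then show ?thesis
    using assms by (simp add: gadget_fails_def)
qed

section \<open>The Markov chain of mode and current state\<close>

locale finite_memory =
  fixes B :: "nat set" and \<tau> :: "nat \<Rightarrow> nat \<times> nat \<Rightarrow> (nat \<times> nat) pmf"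
  assumes finite_B: "finite B"
    and update: "memory_update gadgets B \<tau>"
begin

text \<open>The time in the state replaces the step counter, so the chain of mode and state is
  time-homogeneous even if \<open>\<tau>\<close> depends on the step. This is where a step counter
  turns out to give no advantage.\<close>

definition \<kappa> :: "nat \<times> nat \<Rightarrow> (nat \<times> nat) pmf" where
  "\<kappa> = (\<lambda>(m, s). \<tau> (time s) (m, s))"

abbreviation E :: "nat \<times> nat list \<Rightarrow> (nat \<times> nat list) pmf" where
  "E \<equiv> mode_extend \<tau>"

lemma set_pmf_\<kappa>:
  assumes "y \<in> set_pmf (\<kappa> (m, s))" "m \<in> B"
  shows "fst y \<in> B" "(s, snd y) \<in> transitions gadgets"
proof -
  have "fst y \<in> B \<and> snd y \<in> successors gadgets s"
  proof (cases "s \<in> controlled gadgets")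
    case True
    then have "set_pmf (\<tau> (time s) (m, s)) \<subseteq> B \<times> successors gadgets s"
      using update assms(2) by (simp add: memory_update_def)
    then show ?thesis
      using assms(1) by (auto simp: \<kappa>_def)
  next
    case False
    then have r: "s \<in> random_states gadgets"
      by (simp add: random_states_def)
    then have f: "fst ` set_pmf (\<tau> (time s) (m, s)) \<subseteq> B"
      "map_pmf snd (\<tau> (time s) (m, s)) = probs gadgets s"
      using update assms(2) by (simp_all add: memory_update_def)
    have "snd y \<in> set_pmf (probs gadgets s)"
      using assms(1) unfolding f(2)[symmetric] by (simp add: \<kappa>_def)
    moreover have "set_pmf (probs gadgets s) \<subseteq> successors gadgets s"
      using countable_mdp_gadgets r by (simp add: countable_mdp_def)
    ultimately show ?thesis
      using f(1) assms(1) by (auto simp: \<kappa>_def)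
  qed
  then show "fst y \<in> B" "(s, snd y) \<in> transitions gadgets"
    by (simp_all add: in_successors)
qed

lemma mode_extend_eq:
  assumes "consistent \<rho>"
  shows "E (m, \<rho>) = map_pmf (\<lambda>(m', s). (m', \<rho> @ [s])) (\<kappa> (m, last \<rho>))"
  using consistent_last[OF assms] by (simp add: mode_extend_def \<kappa>_def)

lemma reachable:
  assumes "m \<in> B" "consistent \<rho>" "y \<in> set_pmf (iter_pmf E k (m, \<rho>))"
  shows "fst y \<in> B" "consistent (snd y)" "length (snd y) = length \<rho> + k"
    "\<And>t. t < length \<rho> \<Longrightarrow> snd y ! t = \<rho> ! t"
proof -
  have "fst y \<in> B \<and> consistent (snd y) \<and> length (snd y) = length \<rho> + k \<and> (\<forall>t<length \<rho>. snd y ! t = \<rho> ! t)"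
    using assms(3)
  proof (induction k arbitrary: y)
    case 0
    then show ?case using assms(1,2) by simp
  next
    case (Suc k)
    from Suc.prems obtain x where x: "x \<in> set_pmf (iter_pmf E k (m, \<rho>))" "y \<in> set_pmf (E x)"
      by auto
    from Suc.IH[OF x(1)] have IH: "fst x \<in> B" "consistent (snd x)" "length (snd x) = length \<rho> + k"
      "\<forall>t<length \<rho>. snd x ! t = \<rho> ! t" by auto
    obtain m' s where y: "y = (m', snd x @ [s])" "(m', s) \<in> set_pmf (\<kappa> (fst x, last (snd x)))"
      using x(2) mode_extend_eq[OF IH(2), of "fst x"] by auto
    show ?case
      using set_pmf_\<kappa>[OF y(2) IH(1)] IH consistent_snoc[OF IH(2)] by (simp add: y(1) nth_append)
  qed
  then show "fst y \<in> B" "consistent (snd y)" "length (snd y) = length \<rho> + k"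
    "\<And>t. t < length \<rho> \<Longrightarrow> snd y ! t = \<rho> ! t" by auto
qed

lemma map_last_iter:
  assumes "m \<in> B" "consistent \<rho>"
  shows "map_pmf (map_prod id last) (iter_pmf E k (m, \<rho>)) = iter_pmf \<kappa> k (m, last \<rho>)"
proof -
  have "map_pmf (map_prod id last) (iter_pmf E k (m, \<rho>)) = iter_pmf \<kappa> k (map_prod id last (m, \<rho>))"
  proof (rule iter_pmf_lump[where P = "\<lambda>(m, \<rho>). m \<in> B \<and> consistent \<rho>"])
    fix x y :: "nat \<times> nat list"
    assume x: "case x of (m, \<rho>) \<Rightarrow> m \<in> B \<and> consistent \<rho>"
    obtain m \<rho> where [simp]: "x = (m, \<rho>)" by (cases x)
    have x': "m \<in> B" "consistent \<rho>" using x by auto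
    show "case y of (m, \<rho>) \<Rightarrow> m \<in> B \<and> consistent \<rho>" if "y \<in> set_pmf (E x)"
      using reachable[OF x', of y 1] that by (auto simp: bind_return_pmf)
    show "map_pmf (map_prod id last) (E x) = \<kappa> (map_prod id last x)"
      by (simp add: mode_extend_eq[OF x'(2)] pmf.map_comp o_def case_prod_unfold)
  qed (use assms in auto)
  then show ?thesis by simp
qed

text \<open>Later steps only append to a history, so the entry written after \<open>a\<close> steps
  keeps the law of the chain at step \<open>a\<close> although the history runs on to step
  \<open>k\<close>.\<close>

lemma prob_at:
  assumes "m \<in> B" "consistent \<rho>" "a \<le> k"
  shows "measure_pmf.prob (iter_pmf E k (m, \<rho>)) {y. P (snd y ! (length \<rho> - 1 + a))} =
    measure_pmf.prob (iter_pmf \<kappa> a (m, last \<rho>)) {z. P (snd z)}"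
proof -
  have ne: "\<rho> \<noteq> []" using assms(2) by (simp add: consistent_def)
  let ?A = "{y. P (snd y ! (length \<rho> - 1 + a))}"
  have "measure_pmf.prob (iter_pmf E k (m, \<rho>)) ?A =
    (\<integral>y. measure_pmf.prob (iter_pmf E (k - a) y) ?A \<partial>measure_pmf (iter_pmf E a (m, \<rho>)))"
    using iter_pmf_add[of E a "k - a" "(m, \<rho>)"] assms(3) by (simp add: prob_bind_pmf)
  also have "\<dots> = (\<integral>y. indicator {y. P (last (snd y))} y \<partial>measure_pmf (iter_pmf E a (m, \<rho>)))"
  proof (rule integral_cong_AE)
    show "AE y in measure_pmf (iter_pmf E a (m, \<rho>)).
      measure_pmf.prob (iter_pmf E (k - a) y) ?A = indicator {y. P (last (snd y))} y"
      unfolding AE_measure_pmf_iff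
    proof
      fix y assume y: "y \<in> set_pmf (iter_pmf E a (m, \<rho>))"
      note r = reachable[OF assms(1,2) y]
      have pos: "0 < length \<rho>" using ne by simp
      have idx: "length \<rho> - 1 + a < length (snd y)" and len: "length (snd y) - 1 = length \<rho> - 1 + a"
        using r(3) pos by linarith+
      then have "snd y \<noteq> []" by auto
      from last_conv_nth[OF this] have last: "last (snd y) = snd y ! (length \<rho> - 1 + a)"
        unfolding len .
      have z: "snd z ! (length \<rho> - 1 + a) = last (snd y)" if "z \<in> set_pmf (iter_pmf E (k - a) y)" for z
        using reachable(4)[OF r(1,2), of z "k - a" "length \<rho> - 1 + a"] that idx unfolding last prod.collapse by blast
      show "measure_pmf.prob (iter_pmf E (k - a) y) ?A = indicator {y. P (last (snd y))} y"
      proof (cases "P (last (snd y))")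
        case True
        then show ?thesis
          using z by (auto simp: measure_pmf.prob_eq_1 AE_measure_pmf_iff)
      next
        case False
        then show ?thesis
          using z by (auto simp: measure_pmf.prob_eq_0 AE_measure_pmf_iff)
      qed
    qed
  qed auto
  also have "\<dots> = measure_pmf.prob (map_pmf (map_prod id last) (iter_pmf E a (m, \<rho>))) {z. P (snd z)}"
    by (simp add: vimage_def)
  finally show ?thesis
    by (simp only: map_last_iter[OF assms(1,2)])
qed

text \<open>A lower bound on a transition probability that is uniform in the memory mode.\<close>

definition reach :: "nat \<Rightarrow> nat \<Rightarrow> nat \<Rightarrow> real \<Rightarrow> bool" where
  "reach a s s' p \<longleftrightarrow> (\<forall>m\<in>B. p \<le> measure_pmf.prob (iter_pmf \<kappa> a (m, s)) (B \<times> {s'}))"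

lemma reach_0: "reach 0 s s 1"
  by (simp add: reach_def)

text \<open>Bounds that are uniform in the mode can be concatenated without knowing in which mode
  the intermediate state is reached.\<close>

lemma reach_add:
  assumes "reach a s s' p" "reach b s' s'' q" "0 \<le> q"
  shows "reach (a + b) s s'' (p * q)"
  unfolding reach_def
proof
  fix m assume m: "m \<in> B"
  have "p * q \<le> measure_pmf.prob (iter_pmf \<kappa> a (m, s)) (B \<times> {s'}) * q"
    using assms(1,3) m by (intro mult_right_mono) (auto simp: reach_def)
  also have "\<dots> = (\<integral>y. indicator (B \<times> {s'}) y * q \<partial>measure_pmf (iter_pmf \<kappa> a (m, s)))"
    by simp
  also have "\<dots> \<le> (\<integral>y. measure_pmf.prob (iter_pmf \<kappa> b y) (B \<times> {s''}) \<partial>measure_pmf (iter_pmf \<kappa> a (m, s)))"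
  proof (rule integral_mono)
    show "integrable (measure_pmf (iter_pmf \<kappa> a (m, s))) (\<lambda>y. indicator (B \<times> {s'}) y * q)"
      by (rule measure_pmf.integrable_const_bound[where B = q])
         (use assms(3) in \<open>auto split: split_indicator\<close>)
    show "integrable (measure_pmf (iter_pmf \<kappa> a (m, s))) (\<lambda>y. measure_pmf.prob (iter_pmf \<kappa> b y) (B \<times> {s''}))"
      by (rule measure_pmf.integrable_const_bound[where B = 1]) auto
    show "indicator (B \<times> {s'}) y * q \<le> measure_pmf.prob (iter_pmf \<kappa> b y) (B \<times> {s''})" for y
      using assms(2) by (auto simp: reach_def split: split_indicator)
  qed
  also have "\<dots> = measure_pmf.prob (iter_pmf \<kappa> (a + b) (m, s)) (B \<times> {s''})"
    by (simp only: iter_pmf_add prob_bind_pmf)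
  finally show "p * q \<le> measure_pmf.prob (iter_pmf \<kappa> (a + b) (m, s)) (B \<times> {s''})" .
qed

text \<open>At random states \<open>memory_update\<close> prescribes the marginal law of the next
  state: the new mode may depend on nature's move but cannot influence it.\<close>

lemma reach_step:
  assumes i: "i < half_length n" and nc: "\<not> (h \<and> i < level n \<and> d = Suc i)"
  shows "reach 1 (state (half_start n h + i) d) (state (half_start n h + Suc i) d') (pmf (tag_law n h i d) d')"
  unfolding reach_def
proof
  fix m assume m: "m \<in> B"
  let ?s = "state (half_start n h + i) d" and ?s' = "state (half_start n h + Suc i) d'"
  have r: "?s \<in> random_states gadgets"
    using in_controlled[OF i] nc by (simp add: random_states_def)
  then have "map_pmf snd (\<kappa> (m, ?s)) = probs gadgets ?s"
    using update m by (simp add: memory_update_def \<kappa>_def)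
  then have "pmf (tag_law n h i d) d' = pmf (map_pmf snd (\<kappa> (m, ?s))) ?s'"
    using pmf_probs_gadgets[OF i, of h d d'] by simp
  also have "\<dots> = measure_pmf.prob (\<kappa> (m, ?s)) (snd -` {?s'})"
    by (simp add: pmf_map)
  also have "\<dots> = measure_pmf.prob (\<kappa> (m, ?s)) (B \<times> {?s'})"
    by (rule measure_pmf.finite_measure_eq_AE)
       (use set_pmf_\<kappa>(1)[OF _ m] in \<open>auto simp: AE_measure_pmf_iff\<close>)
  finally show "pmf (tag_law n h i d) d' \<le> measure_pmf.prob (iter_pmf \<kappa> 1 (m, ?s)) (B \<times> {?s'})"
    by (simp add: bind_return_pmf)
qed

lemma reach_Suc:
  assumes "reach a s (state (half_start n h + i) d) p" "i < half_length n"
    "\<not> (h \<and> i < level n \<and> d = Suc i)" "q = pmf (tag_law n h i d) d'"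
  shows "reach (Suc a) s (state (half_start n h + Suc i) d') (p * q)"
  using reach_add[OF assms(1) reach_step[OF assms(2,3), of d']] by (simp add: assms(4))

section \<open>Uniform bounds for nature's counter and for a loss\<close>

lemma reach_lost: "reach k (state t 0) (state (t + k) 0) 1"
proof (induction k)
  case 0
  then show ?case by (simp add: reach_0)
next
  case (Suc k)
  obtain n h i where t: "t + k = half_start n h + i" "i < half_length n" by (rule time_cases)
  have *: "t + Suc k = half_start n h + Suc i"
    using t(1) by simp
  show ?case
    using reach_Suc[OF Suc[unfolded t(1)] t(2), of 1 0] unfolding * by (simp add: tag_law_def)
qed

lemma reach_active:
  "l \<le> level n \<Longrightarrow>
   reach l (state (gadget_start n) 1) (state (half_start n False + l) (Suc l)) (\<Prod>k<l. 1 - ratio n ^ (level n - k))"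
proof (induction l)
  case 0
  then show ?case using reach_0[of "state (gadget_start n) 1"] by simp
next
  case (Suc l)
  then have l: "l < level n" "l < half_length n"
    using half_length_gt[of n] by auto
  then show ?case
    using reach_Suc[OF Suc.IH l(2), of "1 - ratio n ^ (level n - l)" "Suc (Suc l)"] ratio_power_le_one[of n "level n - l"]
    by (simp add: tag_law_def pmf_mix ratio_bounds less_imp_le)
qed

lemma reach_stopped:
  assumes i: "i < level n"
  shows "Suc i + k \<le> level n \<Longrightarrow>
   reach (Suc i + k) (state (gadget_start n) 1) (state (half_start n False + (Suc i + k)) (Suc i))
     ((\<Prod>k<i. 1 - ratio n ^ (level n - k)) * ratio n ^ (level n - i))"
proof (induction k)
  case 0
  have l: "i < half_length n" using i half_length_gt[of n] by simp
  show ?case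
    using reach_Suc[OF reach_active[of i n] l, of "ratio n ^ (level n - i)" "Suc i"] i ratio_power_le_one[of n "level n - i"]
    by (simp add: tag_law_def pmf_mix ratio_bounds less_imp_le)
next
  case (Suc k)
  then have l: "Suc i + k < level n" "Suc i + k < half_length n"
    using half_length_gt[of n] by auto
  then show ?case
    using reach_Suc[OF Suc.IH l(2), of 1 "Suc i"] by (simp add: tag_law_def)
qed

text \<open>Nature must not stop at any \<open>k < i\<close>. By the Weierstrass product inequality
  this has probability at least \<open>1 - level n * ratio n\<close>, and
  \<open>K * 2^-K \<le> 1 / 2\<close>.\<close>

lemma reach_counter:
  assumes i: "i \<le> level n"
  shows "reach (level n) (state (gadget_start n) 1) (state (half_start n False + level n) (Suc i))
     (ratio n ^ (level n - i) / 2)"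
proof -
  let ?p = "\<Prod>k<i. 1 - ratio n ^ (level n - k)"
  have r: "reach (level n) (state (gadget_start n) 1) (state (half_start n False + level n) (Suc i)) (?p * ratio n ^ (level n - i))"
  proof (cases "i = level n")
    case True
    then show ?thesis using reach_active[of "level n" n] by simp
  next
    case False
    then show ?thesis using reach_stopped[of i n "level n - Suc i"] i by simp
  qed
  have "(\<Sum>k<i. ratio n ^ (level n - k)) \<le> (\<Sum>k<i. ratio n ^ 1)"
    using i ratio_bounds[of n] by (intro sum_mono power_decreasing) auto
  also have "\<dots> \<le> real (level n) * ratio n"
    using i ratio_bounds[of n] by (simp add: mult_right_mono)
  also have "\<dots> \<le> 1 / 2"
    using half_pow_mult_nat[of "level n"] by (simp add: ratio_def mult.commute)
  finally have "1 / 2 \<le> 1 - (\<Sum>k<i. ratio n ^ (level n - k))" by simp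
  also have "\<dots> \<le> ?p"
    by (rule Weierstrass_prod_ineq) (use ratio_bounds[of n] in \<open>auto simp: ratio_power_le_one\<close>)
  finally have "1 / 2 * ratio n ^ (level n - i) \<le> ?p * ratio n ^ (level n - i)"
    using ratio_bounds[of n] by (intro mult_right_mono) auto
  then show ?thesis
    using r unfolding reach_def by (auto intro: order_trans)
qed

lemma reach_loss:
  assumes c: "c < level n"
  shows "reach (half_length n - level n) (state (half_start n True + level n) (Suc c)) (state (gadget_start (Suc n)) 0)
    (ratio n ^ Suc c)"
proof -
  have l: "level n < half_length n" using half_length_gt[of n] by simp
  have "pmf (tag_law n True (level n) (Suc c)) 0 = ratio n ^ Suc c"
    using c ratio_power_le_one[of n "Suc c"] ratio_bounds[of n] by (simp add: tag_law_def pmf_mix)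
  then have 1: "reach 1 (state (half_start n True + level n) (Suc c)) (state (half_start n True + Suc (level n)) 0) (ratio n ^ Suc c)"
    using reach_step[OF l, of True "Suc c" 0] by simp
  have t: "half_start n True + Suc (level n) + (half_length n - Suc (level n)) = gadget_start (Suc n)"
    using half_start_add(2)[of n] half_length_gt[of n] by linarith
  have "reach (1 + (half_length n - Suc (level n))) (state (half_start n True + level n) (Suc c)) (state (gadget_start (Suc n)) 0) (ratio n ^ Suc c * 1)"
    using reach_add[OF 1 reach_lost[of "half_length n - Suc (level n)" "half_start n True + Suc (level n)"]] unfolding t by simp
  moreover have "1 + (half_length n - Suc (level n)) = half_length n - level n"
    using l by simp
  ultimately show ?thesis by simp
qed

lemma choose_support:
  assumes "m \<in> B" "a \<le> level n" "y \<in> set_pmf (iter_pmf \<kappa> a (m, state (half_start n h) 1))"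
  shows "fst y \<in> B \<and> time (snd y) = half_start n h + a \<and> 1 \<le> tag (snd y)"
  using assms(2,3)
proof (induction a arbitrary: y)
  case 0
  then show ?case using assms(1) by simp
next
  case (Suc a)
  from Suc.prems obtain x where x: "x \<in> set_pmf (iter_pmf \<kappa> a (m, state (half_start n h) 1))" "y \<in> set_pmf (\<kappa> x)"
    by auto
  from Suc.IH[OF _ x(1)] Suc.prems have IH: "fst x \<in> B" "time (snd x) = half_start n h + a" "1 \<le> tag (snd x)"
    by auto
  have a: "a < level n" "a < half_length n"
    using Suc.prems half_length_gt[of n] by auto
  have "fst y \<in> B" "(snd x, snd y) \<in> transitions gadgets"
    using set_pmf_\<kappa>[of y "fst x" "snd x"] x(2) IH(1) by auto
  then show ?case
    using IH a by (auto simp: in_transitions next_tags_def split: if_splits)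
qed

end


section \<open>Every finite memory fails\<close>

lemma prob_ge_integral:
  fixes X :: "'a pmf"
  assumes "\<And>y. y \<in> set_pmf X \<Longrightarrow> g y \<le> measure_pmf.prob (f y) A" "\<And>y. \<bar>g y\<bar> \<le> (c :: real)"
  shows "(\<integral>y. g y \<partial>measure_pmf X) \<le> measure_pmf.prob (bind_pmf X f) A"
  unfolding prob_bind_pmf
proof (rule integral_mono_AE)
  show "integrable (measure_pmf X) g"
    by (rule measure_pmf.integrable_const_bound[where B = c]) (use assms(2) in auto)
  show "integrable (measure_pmf X) (\<lambda>y. measure_pmf.prob (f y) A)"
    by (rule measure_pmf.integrable_const_bound[where B = 1]) auto
qed (use assms(1) in \<open>simp add: AE_measure_pmf_iff\<close>)

context finite_memory
begin

text \<open>For each \<open>i\<close> some mode carries at least the average share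
  \<open>w i / card B\<close>. Assigning such a mode to each of the \<open>K + 1\<close> values of
  \<open>i\<close> cannot be injective.\<close>

lemma pigeonhole_modes:
  assumes card: "card B \<le> K" and m0: "m0 \<in> B"
    and \<mu>: "\<And>i. i \<le> K \<Longrightarrow> w i \<le> (\<Sum>m\<in>B. \<mu> i m)"
  shows "\<exists>i j m. i < j \<and> j \<le> K \<and> m \<in> B \<and> w i / card B \<le> \<mu> i m \<and> w j / card B \<le> (\<mu> j m :: real)"
proof -
  have cB: "0 < card B" using finite_B m0 by (auto simp: card_gt_0_iff)
  have "\<exists>m\<in>B. w i / card B \<le> \<mu> i m" if "i \<le> K" for i
  proof (rule ccontr)
    assume "\<not> (\<exists>m\<in>B. w i / card B \<le> \<mu> i m)"
    then have "(\<Sum>m\<in>B. \<mu> i m) < (\<Sum>m\<in>B. w i / card B)"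
      using m0 finite_B by (intro sum_strict_mono) auto
    then show False using \<mu>[OF that] cB by simp
  qed
  then obtain g where g: "\<And>i. i \<le> K \<Longrightarrow> g i \<in> B \<and> w i / card B \<le> \<mu> i (g i)"
    by metis
  have "\<not> inj_on g {..K}"
  proof
    assume "inj_on g {..K}"
    then have "card {..K} \<le> card B"
      using g finite_B by (intro card_inj_on_le) auto
    then show False using card by simp
  qed
  then obtain i j where ij: "i \<le> K" "j \<le> K" "g i = g j" "i \<noteq> j"
    by (auto simp: inj_on_def)
  show ?thesis
  proof (cases "i < j")
    case True
    then show ?thesis using g[OF ij(1)] g[OF ij(2)] ij by metis
  next
    case False
    then have "j < i" using ij by simp
    then show ?thesis using g[OF ij(1)] g[OF ij(2)] ij by metis
  qed
qed

abbreviation fails :: "nat \<Rightarrow> (nat \<times> nat list) set" where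
  "fails n \<equiv> {z. gadget_fails (\<lambda>t. tag (snd z ! t)) n}"

text \<open>\<open>G\<close> is the probability of an answer above \<open>i\<close>; it depends on
  the mode \<open>m\<close> but not on nature's counter, since the half always starts in the same
  state. Answers above \<open>i\<close> fail if nature's counter was \<open>i\<close>; the other
  answers are lost with probability at least \<open>ratio n ^ Suc i\<close>, whatever nature's
  counter was.\<close>

lemma second_half_fails:
  fixes i m n :: nat and \<rho> :: "nat list"
  assumes m: "m \<in> B" and \<rho>: "consistent \<rho>" "length \<rho> = Suc (half_start n True)"
    and last: "last \<rho> = state (half_start n True) 1"
  defines "G \<equiv> measure_pmf.prob (iter_pmf \<kappa> (level n) (m, state (half_start n True) 1)) {z. Suc i < tag (snd z)}"
  shows "tag (\<rho> ! (gadget_start n + level n)) = Suc i \<Longrightarrow>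
      G \<le> measure_pmf.prob (iter_pmf E (half_length n) (m, \<rho>)) (fails n)" (is "_ \<Longrightarrow> _ \<le> ?F")
    and "i < level n \<Longrightarrow> (1 - G) * ratio n ^ Suc i \<le> measure_pmf.prob (iter_pmf E (half_length n) (m, \<rho>)) (fails n)"
proof -
  have l: "level n < half_length n" using half_length_gt[of n] by simp
  have len: "length \<rho> - 1 = half_start n True" using \<rho>(2) by simp
  {
    assume t: "tag (\<rho> ! (gadget_start n + level n)) = Suc i"
    have "G = measure_pmf.prob (iter_pmf E (half_length n) (m, \<rho>)) {y. Suc i < tag (snd y ! (half_start n True + level n))}"
      using prob_at[OF m \<rho>(1), of "level n" "half_length n" "\<lambda>s. Suc i < tag s", unfolded len last] l
      by (simp add: G_def)
    also have "\<dots> \<le> ?F"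
    proof (rule measure_pmf.finite_measure_mono_AE)
      have "gadget_start n + level n < length \<rho>"
        using l \<rho>(2) by (simp add: half_start_def)
      then show "AE y in measure_pmf (iter_pmf E (half_length n) (m, \<rho>)).
        y \<in> {y. Suc i < tag (snd y ! (half_start n True + level n))} \<longrightarrow> y \<in> fails n"
        using reachable(4)[OF m \<rho>(1)] t by (auto simp: AE_measure_pmf_iff gadget_fails_def)
    qed simp
    finally show "G \<le> ?F" .
  }
  assume i: "i < level n"
  let ?X = "iter_pmf \<kappa> (level n) (m, state (half_start n True) 1)"
  let ?S = "{z. tag (snd z) = 0} :: (nat \<times> nat) set"
  have "(1 - G) * ratio n ^ Suc i = measure_pmf.prob ?X (- {z. Suc i < tag (snd z)}) * ratio n ^ Suc i"
    using measure_pmf.prob_compl[of "{z. Suc i < tag (snd z)}" ?X] by (simp add: G_def Compl_eq_Diff_UNIV)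
  also have "\<dots> = (\<integral>z. indicator (- {z. Suc i < tag (snd z)}) z * ratio n ^ Suc i \<partial>measure_pmf ?X)"
    by simp
  also have "\<dots> \<le> measure_pmf.prob (bind_pmf ?X (iter_pmf \<kappa> (half_length n - level n))) ?S"
  proof (rule prob_ge_integral[where c = 1])
    show "\<bar>indicator (- {z. Suc i < tag (snd z)}) y * ratio n ^ Suc i\<bar> \<le> 1" for y
      using ratio_power_le_one[of n "Suc i"] ratio_bounds[of n] by (auto split: split_indicator)
    fix z assume z: "z \<in> set_pmf ?X"
    show "indicator (- {z. Suc i < tag (snd z)}) z * ratio n ^ Suc i
      \<le> measure_pmf.prob (iter_pmf \<kappa> (half_length n - level n) z) ?S"
    proof (cases "Suc i < tag (snd z)")
      case False
      have s: "fst z \<in> B" "time (snd z) = half_start n True + level n" "1 \<le> tag (snd z)"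
        using choose_support[OF m order_refl z] by auto
      define c where "c = tag (snd z) - 1"
      have c: "c \<le> i" "snd z = state (half_start n True + level n) (Suc c)"
        using s False state_time_tag[of "snd z"] by (auto simp: c_def)
      \<comment> \<open>A smaller counter \<open>c\<close> is even riskier.\<close>
      have "ratio n ^ Suc i \<le> ratio n ^ Suc c"
        using c ratio_bounds[of n] by (intro power_decreasing) auto
      also have "\<dots> \<le> measure_pmf.prob (iter_pmf \<kappa> (half_length n - level n) (fst z, snd z)) (B \<times> {state (gadget_start (Suc n)) 0})"
        using reach_loss[of c n] c i s(1) unfolding reach_def by simp
      also have "\<dots> \<le> measure_pmf.prob (iter_pmf \<kappa> (half_length n - level n) (fst z, snd z)) ?S"
        by (intro measure_pmf.finite_measure_mono) auto
      finally show ?thesis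
        using False by simp
    qed simp
  qed
  also have "\<dots> = measure_pmf.prob (iter_pmf \<kappa> (half_length n) (m, last \<rho>)) ?S"
    using iter_pmf_add[of \<kappa> "level n" "half_length n - level n"] l by (simp add: last)
  also have "\<dots> = measure_pmf.prob (iter_pmf E (half_length n) (m, \<rho>)) {y. tag (snd y ! (gadget_start (Suc n))) = 0}"
    using prob_at[OF m \<rho>(1), of "half_length n" "half_length n" "\<lambda>s. tag s = 0", unfolded len half_start_add] by simp
  also have "\<dots> \<le> ?F"
    by (intro measure_pmf.finite_measure_mono) (auto simp: gadget_fails_def)
  finally show "(1 - G) * ratio n ^ Suc i \<le> ?F" .
qed

lemma first_half_last:
  assumes "consistent \<rho>" "length \<rho> = Suc (half_start n True)" "tag (\<rho> ! gadget_start n) = 1"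
    "tag (\<rho> ! (gadget_start n + level n)) \<noteq> 0"
  shows "last \<rho> = state (half_start n True) 1"
proof -
  have len: "half_start n False + half_length n = length \<rho> - 1"
    using assms(2) by (simp add: half_start_add)
  interpret half_path n False "\<lambda>i. tag (\<rho> ! (half_start n False + i))"
  proof
    fix i assume "i < half_length n"
    then show "tag (\<rho> ! (half_start n False + Suc i)) \<in> next_tags n False i (tag (\<rho> ! (half_start n False + i)))"
      using len by (intro consistent_next_tags[OF assms(1)]) auto
  qed (use assms in simp)
  have "tag (\<rho> ! (half_start n False + half_length n)) = 1"
    using merge risk assms(4) by simp
  then have "tag (last \<rho>) = 1"
    using assms(2) by (subst last_conv_nth) (auto simp: half_start_add)
  moreover have "time (last \<rho>) = half_start n True"
    using consistent_last[OF assms(1)] assms(2) by simp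
  ultimately show ?thesis
    using state_time_tag[of "last \<rho>"] by simp
qed

text \<open>Let \<open>m'\<close> be a mode shared by \<open>i < j\<close> and \<open>G\<close> its
  probability of answering above \<open>i\<close>. Failures after \<open>i\<close> contribute
  \<open>\<mu> i m' * G\<close>, those after \<open>j\<close> contribute
  \<open>\<mu> j m' * ratio n ^ Suc i * (1 - G)\<close>. Both coefficients are at least the claimed
  bound, so no value of \<open>G\<close> helps the player.\<close>

lemma gadget_fails_prob:
  assumes m: "m \<in> B" and \<rho>: "consistent \<rho>" "length \<rho> = Suc (gadget_start n)"
    and last: "last \<rho> = state (gadget_start n) 1" and card: "card B \<le> level n"
  shows "ratio n ^ level n / (2 * card B) \<le> measure_pmf.prob (iter_pmf E (2 * half_length n) (m, \<rho>)) (fails n)"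
proof -
  let ?X = "iter_pmf E (half_length n) (m, \<rho>)"
  let ?a = "gadget_start n + level n"
  let ?Y = "\<lambda>i m'. {y. fst y = m' \<and> tag (snd y ! ?a) = Suc i}"
  define \<mu> where "\<mu> i m' = measure_pmf.prob ?X (?Y i m')" for i m'
  have l: "level n < half_length n" using half_length_gt[of n] by simp
  have "ratio n ^ (level n - i) / 2 \<le> (\<Sum>m'\<in>B. \<mu> i m')" if i: "i \<le> level n" for i
  proof -
    have "ratio n ^ (level n - i) / 2 \<le> measure_pmf.prob (iter_pmf \<kappa> (level n) (m, last \<rho>)) (B \<times> {state ?a (Suc i)})"
      using reach_counter[OF i] m by (simp add: reach_def last)
    also have "\<dots> \<le> measure_pmf.prob (iter_pmf \<kappa> (level n) (m, last \<rho>)) {z. tag (snd z) = Suc i}"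
      by (intro measure_pmf.finite_measure_mono) auto
    also have "\<dots> = measure_pmf.prob ?X {y. tag (snd y ! ?a) = Suc i}"
      using prob_at[OF m \<rho>(1), of "level n" "half_length n" "\<lambda>s. tag s = Suc i"] l \<rho>(2) by simp
    also have "\<dots> = measure_pmf.prob ?X (\<Union>m'\<in>B. ?Y i m')"
      by (rule measure_pmf.finite_measure_eq_AE)
         (use reachable(1)[OF m \<rho>(1)] in \<open>auto simp: AE_measure_pmf_iff\<close>)
    also have "\<dots> = (\<Sum>m'\<in>B. \<mu> i m')"
      unfolding \<mu>_def using finite_B
      by (intro measure_pmf.finite_measure_finite_Union) (auto simp: disjoint_family_on_def)
    finally show ?thesis .
  qed
  from pigeonhole_modes[OF card m this, of "\<lambda>i. i"]
  obtain i j m' where ij: "i < j" "j \<le> level n" and m': "m' \<in> B"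
    and \<mu>i: "ratio n ^ (level n - i) / 2 / card B \<le> \<mu> i m'"
    and \<mu>j: "ratio n ^ (level n - j) / 2 / card B \<le> \<mu> j m'"
    by blast
  let ?c = "ratio n ^ level n / (2 * card B)"
  define G where "G = measure_pmf.prob (iter_pmf \<kappa> (level n) (m', state (half_start n True) 1)) {z. Suc i < tag (snd z)}"
  have G: "0 \<le> G" "G \<le> 1" by (simp_all add: G_def)
  have r: "0 < ratio n" "ratio n \<le> 1" using ratio_bounds[of n] by auto
  have "ratio n ^ level n \<le> ratio n ^ (level n - i)"
    using r by (intro power_decreasing) auto
  then have "?c \<le> ratio n ^ (level n - i) / 2 / card B"
    by (simp add: divide_right_mono)
  then have ci: "?c \<le> \<mu> i m'"
    using \<mu>i by linarith
  \<comment> \<open>The order \<open>i < j\<close> is decisive here: the exponents of nature's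
    choice and of the risk add up to at most \<open>level n\<close>.\<close>
  have "ratio n ^ level n \<le> ratio n ^ ((level n - j) + Suc i)"
    using r ij by (intro power_decreasing) auto
  then have "?c \<le> ratio n ^ (level n - j) * ratio n ^ Suc i / (2 * card B)"
    unfolding power_add by (rule divide_right_mono) simp
  also have "\<dots> = ratio n ^ (level n - j) / 2 / card B * ratio n ^ Suc i"
    by simp
  also have "\<dots> \<le> \<mu> j m' * ratio n ^ Suc i"
    using \<mu>j r by (intro mult_right_mono) auto
  finally have cj: "?c \<le> \<mu> j m' * ratio n ^ Suc i" .
  \<comment> \<open>\<open>G\<close> and \<open>1 - G\<close> are convex weights, so the unknown
    behaviour of the mode cancels.\<close>
  have "?c = ?c * G + ?c * (1 - G)"
    by (simp only: distrib_left[symmetric]) simp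
  also have "\<dots> \<le> \<mu> i m' * G + \<mu> j m' * ratio n ^ Suc i * (1 - G)"
    using ci cj G by (intro add_mono mult_right_mono) auto
  also have "\<dots> = (\<integral>y. indicator (?Y i m') y * G + indicator (?Y j m') y * ((1 - G) * ratio n ^ Suc i) \<partial>measure_pmf ?X)"
  proof -
    have int: "integrable (measure_pmf ?X) (\<lambda>y. indicator A y * c)" for A and c :: real
      by (rule measure_pmf.integrable_const_bound[where B = "\<bar>c\<bar>"]) (auto split: split_indicator)
    show ?thesis
      by (subst Bochner_Integration.integral_add[OF int int]) (simp add: \<mu>_def)
  qed
  also have "\<dots> \<le> measure_pmf.prob (bind_pmf ?X (iter_pmf E (half_length n))) (fails n)"
  proof (rule prob_ge_integral[where c = 1])
    have b: "(1 - G) * ratio n ^ Suc i \<le> 1 * 1" "0 \<le> (1 - G) * ratio n ^ Suc i"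
      using G r ratio_power_le_one[of n "Suc i"] by (intro mult_mono mult_nonneg_nonneg; simp)+
    show "\<bar>indicator (?Y i m') y * G + indicator (?Y j m') y * ((1 - G) * ratio n ^ Suc i)\<bar> \<le> 1" for y
      using b G ij by (auto split: split_indicator)
    fix y assume y: "y \<in> set_pmf ?X"
    note R = reachable[OF m \<rho>(1) y]
    have len: "length (snd y) = Suc (half_start n True)"
      using R(3) \<rho>(2) by (simp add: half_start_add)
    have ne: "\<rho> \<noteq> []" using \<rho>(2) by auto
    have "snd y ! gadget_start n = last \<rho>"
      using R(4)[of "gadget_start n"] \<rho>(2) last_conv_nth[OF ne] by simp
    then have start: "tag (snd y ! gadget_start n) = 1"
      by (simp add: last)
    show "indicator (?Y i m') y * G + indicator (?Y j m') y * ((1 - G) * ratio n ^ Suc i)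
      \<le> measure_pmf.prob (iter_pmf E (half_length n) y) (fails n)"
    proof -
      consider (i) "y \<in> ?Y i m'" | (j) "y \<in> ?Y j m'" "y \<notin> ?Y i m'" | (none) "y \<notin> ?Y i m'" "y \<notin> ?Y j m'"
        by blast
      then show ?thesis
      proof cases
        case i
        then have "last (snd y) = state (half_start n True) 1"
          by (intro first_half_last[OF R(2) len start]) simp
        from second_half_fails(1)[OF R(1,2) len this, of i] i
        have "G \<le> measure_pmf.prob (iter_pmf E (half_length n) y) (fails n)"
          by (auto simp: G_def)
        moreover have "y \<notin> ?Y j m'" using i ij by auto
        ultimately show ?thesis using i by simp
      next
        case j
        then have "last (snd y) = state (half_start n True) 1"
          by (intro first_half_last[OF R(2) len start]) simp
        from second_half_fails(2)[OF R(1,2) len this, of i] j ij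
        have "(1 - G) * ratio n ^ Suc i \<le> measure_pmf.prob (iter_pmf E (half_length n) y) (fails n)"
          by (auto simp: G_def)
        then show ?thesis using j by simp
      next
        case none
        then show ?thesis by simp
      qed
    qed
  qed
  also have "\<dots> = measure_pmf.prob (iter_pmf E (2 * half_length n) (m, \<rho>)) (fails n)"
    by (simp only: iter_pmf_add[symmetric] mult_2)
  finally show ?thesis .
qed

text \<open>The bound of \<open>gadget_fails_prob\<close> holds after every history that is not
  lost, so it survives conditioning on the absence of earlier failures; a lost history fails in
  gadget \<open>n\<close> with probability 1. Gadgets before \<open>n1\<close> get the trivial
  factor 1.\<close>

lemma no_fail_step:
  assumes m0: "m0 \<in> B" and card: "card B \<le> level n"
  shows "measure_pmf.prob (iter_pmf E (gadget_start (Suc n)) (m0, [initial])) {z. \<forall>k. n1 \<le> k \<and> k < Suc n \<longrightarrow> z \<notin> fails k}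
    \<le> (1 - (if n1 \<le> n then ratio n ^ level n / (2 * card B) else 0)) *
      measure_pmf.prob (iter_pmf E (gadget_start n) (m0, [initial])) {z. \<forall>k. n1 \<le> k \<and> k < n \<longrightarrow> z \<notin> fails k}"
  (is "measure_pmf.prob _ ?A' \<le> ?q * measure_pmf.prob ?X ?A")
proof -
  have cB: "0 < card B" using finite_B m0 by (auto simp: card_gt_0_iff)
  have q: "0 \<le> ?q"
    using ratio_power_le_one[of n "level n"] cB by (auto simp: field_simps)
  have init: "consistent [initial]"
    by (simp add: consistent_def initial_def)
  have "measure_pmf.prob (iter_pmf E (gadget_start (Suc n)) (m0, [initial])) ?A' =
    (\<integral>y. measure_pmf.prob (iter_pmf E (2 * half_length n) y) ?A' \<partial>measure_pmf ?X)"
    by (simp only: gadget_start_Suc iter_pmf_add prob_bind_pmf)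
  also have "\<dots> \<le> (\<integral>y. ?q * indicator ?A y \<partial>measure_pmf ?X)"
  proof (rule integral_mono_AE)
    show "integrable (measure_pmf ?X) (\<lambda>y. measure_pmf.prob (iter_pmf E (2 * half_length n) y) ?A')"
      by (rule measure_pmf.integrable_const_bound[where B = 1]) auto
    show "integrable (measure_pmf ?X) (\<lambda>y. ?q * indicator ?A y)"
      by (rule measure_pmf.integrable_const_bound[where B = "\<bar>?q\<bar>"]) (auto split: split_indicator)
    show "AE y in measure_pmf ?X. measure_pmf.prob (iter_pmf E (2 * half_length n) y) ?A' \<le> ?q * indicator ?A y"
      unfolding AE_measure_pmf_iff
    proof
      fix y assume y: "y \<in> set_pmf ?X"
      note R = reachable[OF m0 init y]
      have len: "length (snd y) = Suc (gadget_start n)"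
        using R(3) by simp
      let ?Z = "iter_pmf E (2 * half_length n) (fst y, snd y)"
      show "measure_pmf.prob (iter_pmf E (2 * half_length n) y) ?A' \<le> ?q * indicator ?A y"
      proof (cases "y \<in> ?A")
        case False
        then obtain k where k: "n1 \<le> k" "k < n" "y \<in> fails k" by blast
        have le: "gadget_start (Suc k) \<le> gadget_start n"
          using k(2) strict_mono_less_eq[OF strict_mono_gadget_start, of "Suc k" n] by simp
        have "z \<notin> ?A'" if z: "z \<in> set_pmf ?Z" for z
        proof -
          have "gadget_fails (\<lambda>t. tag (snd z ! t)) k \<longleftrightarrow> gadget_fails (\<lambda>t. tag (snd y ! t)) k"
            using reachable(4)[OF R(1,2) z] le len by (intro gadget_fails_cong) simp
          then show ?thesis using k by auto
        qed
        then have "measure_pmf.prob ?Z ?A' = 0"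
          by (subst measure_pmf.prob_eq_0) (auto simp: AE_measure_pmf_iff)
        then show ?thesis using False by simp
      next
        case True
        have "measure_pmf.prob ?Z ?A' \<le> ?q"
        proof (cases "n1 \<le> n")
          case n1: True
          have "ratio n ^ level n / (2 * card B) \<le> measure_pmf.prob ?Z (fails n)"
          proof (cases "tag (last (snd y)) = 0")
            case True
            then have lst: "last (snd y) = state (gadget_start n) 0"
              using consistent_last[OF R(2)] len state_time_tag[of "last (snd y)"] by simp
            have "ratio n ^ level n / (2 * card B) \<le> 1"
              using ratio_power_le_one[of n "level n"] cB by (simp add: field_simps)
            also have "1 \<le> measure_pmf.prob (iter_pmf \<kappa> (2 * half_length n) (fst y, last (snd y))) {z. tag (snd z) = 0}"
            proof -
              have "1 \<le> measure_pmf.prob (iter_pmf \<kappa> (2 * half_length n) (fst y, last (snd y))) (B \<times> {state (gadget_start n + 2 * half_length n) 0})"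
                using reach_lost[of "2 * half_length n" "gadget_start n"] R(1) by (simp add: reach_def lst)
              also have "\<dots> \<le> measure_pmf.prob (iter_pmf \<kappa> (2 * half_length n) (fst y, last (snd y))) {z. tag (snd z) = 0}"
                by (intro measure_pmf.finite_measure_mono) auto
              finally show ?thesis .
            qed
            also have "\<dots> = measure_pmf.prob ?Z {z. tag (snd z ! gadget_start (Suc n)) = 0}"
              using prob_at[OF R(1,2) order_refl, of "2 * half_length n" "\<lambda>s. tag s = 0"] len by (simp add: gadget_start_Suc)
            also have "\<dots> \<le> measure_pmf.prob ?Z (fails n)"
              by (intro measure_pmf.finite_measure_mono) (auto simp: gadget_fails_def)
            finally show ?thesis .
          next
            case False
            have "snd y ! 0 = initial"
              using R(4)[of 0] by simp
            then have "tag (last (snd y)) = 1"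
              using consistent_tag_le_1[OF R(2) len] False by linarith
            then have "last (snd y) = state (gadget_start n) 1"
              using consistent_last[OF R(2)] len state_time_tag[of "last (snd y)"] by simp
            from gadget_fails_prob[OF R(1,2) len this card] show ?thesis .
          qed
          moreover have "measure_pmf.prob ?Z ?A' \<le> measure_pmf.prob ?Z (- fails n)"
            using n1 by (intro measure_pmf.finite_measure_mono) auto
          moreover have "measure_pmf.prob ?Z (- fails n) = 1 - measure_pmf.prob ?Z (fails n)"
            using measure_pmf.prob_compl[of "fails n" ?Z] by (simp add: Compl_eq_Diff_UNIV)
          ultimately show ?thesis
            using n1 by simp
        qed simp
        then show ?thesis using True by simp
      qed
    qed
  qed
  also have "\<dots> = ?q * measure_pmf.prob ?X ?A"
    by simp
  finally show ?thesis .
qed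

end

text \<open>A conditional Borel-Cantelli argument: given the past, the failure probabilities are
  bounded below by the terms of a divergent series, so almost surely infinitely many gadgets fail,
  whereas \<open>winning_path\<close> allows a winning run only finitely many failures.\<close>

lemma finite_memory_never_wins:
  assumes \<sigma>: "\<sigma> \<in> step_counter_finite_memory_strategies gadgets"
  shows "measure (run_measure gadgets initial \<sigma>) (TP_liminf_ge_0 gadgets) = 0"
proof -
  from \<sigma> obtain B m0 \<tau> where *: "\<sigma> \<in> strategies gadgets" "finite B" "m0 \<in> B"
    "memory_update gadgets B \<tau>" "induced_by gadgets B m0 \<tau> \<sigma>"
    by (auto simp: step_counter_finite_memory_strategies_def)
  interpret finite_memory B \<tau>
    by unfold_locales (use * in auto)
  let ?R = "run_measure gadgets initial \<sigma>"
  interpret R: prob_space ?R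
    by (rule prob_space_run_measure)
  have cB: "0 < card B" using * by (auto simp: card_gt_0_iff)
  let ?N = "\<lambda>n1 n. {\<omega>. \<forall>k. n1 \<le> k \<and> k < n \<longrightarrow> \<not> gadget_fails (\<lambda>t. tag (\<omega> t)) k}"
  have N_prefix: "?N n1 n = {\<omega>. (\<lambda>\<rho>. \<forall>k. n1 \<le> k \<and> k < n \<longrightarrow> \<not> gadget_fails (\<lambda>t. tag (\<rho> ! t)) k) (map \<omega> [0..<Suc (gadget_start n)])}" for n1 n
  proof -
    have "gadget_fails (\<lambda>t. tag (\<omega> t)) k \<longleftrightarrow> gadget_fails (\<lambda>t. tag (map \<omega> [0..<Suc (gadget_start n)] ! t)) k"
      if "k < n" for \<omega> :: "nat \<Rightarrow> nat" and k
    proof (rule gadget_fails_cong)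
      fix t assume "t \<le> gadget_start (Suc k)"
      also have "\<dots> \<le> gadget_start n"
        using that strict_mono_less_eq[OF strict_mono_gadget_start, of "Suc k" n] by simp
      finally show "tag (\<omega> t) = tag (map \<omega> [0..<Suc (gadget_start n)] ! t)"
        by (auto simp: nth_append not_less)
    qed
    then show ?thesis by blast
  qed
  have N_sets: "?N n1 n \<in> R.events" for n1 n
    unfolding N_prefix by (rule sets_prefix)
  define p where "p n1 n = R.prob (?N n1 n)" for n1 n
  have p_eq: "p n1 n = measure_pmf.prob (iter_pmf E (gadget_start n) (m0, [initial])) {z. \<forall>k. n1 \<le> k \<and> k < n \<longrightarrow> z \<notin> fails k}" for n1 n
  proof -
    have "p n1 n = measure_pmf.prob (history gadgets initial \<sigma> (gadget_start n))
        {\<rho>. \<forall>k. n1 \<le> k \<and> k < n \<longrightarrow> \<not> gadget_fails (\<lambda>t. tag (\<rho> ! t)) k}"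
      unfolding p_def N_prefix by (rule run_measure_prefix)
    also have "history gadgets initial \<sigma> (gadget_start n) = map_pmf snd (iter_pmf E (gadget_start n) (m0, [initial]))"
      using map_mode_history[OF *(2-4) countable_mdp_gadgets _ *(1,5)] by simp
    finally show ?thesis
      by (simp add: vimage_def)
  qed
  have "AE \<omega> in ?R. \<not> (\<forall>k\<ge>n0. \<not> gadget_fails (\<lambda>t. tag (\<omega> t)) k)" for n0
  proof -
    \<comment> \<open>From the first gadget of level \<open>card B\<close> on, the pigeonhole
      argument applies.\<close>
    define n1 where "n1 = max n0 (level_start (card B))"
    define c where "c n = (if n1 \<le> n then ratio n ^ level n / (2 * card B) else 0)" for n
    have c0: "0 \<le> c n" for n
      by (simp add: c_def ratio_bounds less_imp_le)
    have p_le: "p n1 n \<le> exp (- (\<Sum>k<n. c k))" for n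
    proof (induction n)
      case 0
      then show ?case by (simp add: p_def)
    next
      case (Suc n)
      show ?case
      proof (cases "n1 \<le> n")
        case True
        then have "card B \<le> level n"
          by (intro level_ge) (simp add: n1_def)
        then have "p n1 (Suc n) \<le> (1 - c n) * p n1 n"
          unfolding p_eq c_def by (rule no_fail_step[OF *(3)])
        also have "\<dots> \<le> exp (- c n) * p n1 n"
          using exp_ge_add_one_self[of "- c n"] by (intro mult_right_mono) (auto simp: p_def)
        also have "\<dots> \<le> exp (- c n) * exp (- (\<Sum>k<n. c k))"
          using Suc by (intro mult_left_mono) auto
        also have "\<dots> = exp (- (\<Sum>k<Suc n. c k))"
          by (simp only: exp_add[symmetric] sum.lessThan_Suc minus_add_distrib add.commute)
        finally show ?thesis .
      next
        case False
        then have "(\<Sum>k<Suc n. c k) = 0"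
          by (intro sum.neutral) (auto simp: c_def)
        then show ?thesis by (simp add: p_def)
      qed
    qed
    have "R.prob (\<Inter>n. ?N n1 n) = 0"
    proof (rule ccontr)
      define q where "q = R.prob (\<Inter>n. ?N n1 n)"
      assume "R.prob (\<Inter>n. ?N n1 n) \<noteq> 0"
      then have q: "0 < q"
        using measure_nonneg[of ?R "\<Inter>n. ?N n1 n"] unfolding q_def by linarith
      \<comment> \<open>A positive probability of never failing would bound all partial sums of the
        divergent series.\<close>
      have "(\<Sum>k<n. c k) \<le> - ln q" for n
      proof -
        have "q \<le> p n1 n"
          unfolding q_def p_def using N_sets by (intro R.finite_measure_mono) auto
        also note p_le[of n]
        finally have "ln q \<le> ln (exp (- (\<Sum>k<n. c k)))"
          using q by (simp only: ln_le_cancel_iff exp_gt_zero)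
        then show ?thesis by simp
      qed
      then have "summable c"
        by (rule summableI_nonneg_bounded[OF c0])
      then have "summable (\<lambda>n. 2 * card B * c n)"
        by (rule summable_mult)
      moreover have "eventually (\<lambda>n. 2 * card B * c n = ratio n ^ level n) sequentially"
        unfolding eventually_sequentially using cB by (intro exI[of _ n1]) (auto simp: c_def)
      then have "summable (\<lambda>n. 2 * card B * c n) = summable (\<lambda>n. ratio n ^ level n)"
        by (rule summable_cong)
      ultimately have "summable (\<lambda>n. ratio n ^ level n)"
        by simp
      then show False
        using not_summable_ratio by blast
    qed
    then have "AE \<omega> in ?R. \<omega> \<notin> (\<Inter>n. ?N n1 n)"
      using N_sets by (subst (asm) R.prob_eq_0) auto
    then show ?thesis
    proof eventually_elim
      case (elim \<omega>)
      then obtain k where "n1 \<le> k" "gadget_fails (\<lambda>t. tag (\<omega> t)) k"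
        by blast
      then show ?case
        by (auto simp: n1_def)
    qed
  qed
  then have "AE \<omega> in ?R. \<forall>n0. \<not> (\<forall>k\<ge>n0. \<not> gadget_fails (\<lambda>t. tag (\<omega> t)) k)"
    by (simp add: AE_all_countable)
  then have "AE \<omega> in ?R. \<omega> \<notin> TP_liminf_ge_0 gadgets"
    using AE_start[where M = gadgets and ?s0.0 = initial and \<sigma> = \<sigma>]
  proof eventually_elim
    case (elim \<omega>)
    show ?case
    proof
      assume "\<omega> \<in> TP_liminf_ge_0 gadgets"
      then have "\<omega> \<in> runs gadgets" "0 \<le> liminf (\<lambda>t. ereal (payoff (\<lambda>t. tag (\<omega> t)) t))"
        using TP_liminf_gadgets[of \<omega>] elim(2) by auto
      then have "\<exists>n0. \<forall>n\<ge>n0. \<not> gadget_fails (\<lambda>t. tag (\<omega> t)) n"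
        using winning_path[OF run_gadgets(2)] elim(2) by blast
      then show False
        using elim(1) by blast
    qed
  qed
  then show ?thesis
    by (subst R.prob_eq_0) (rule sets_TP_liminf_ge_0)
qed

theorem theorem6p7:
  shows "\<exists>(M :: nat mdp) s0.
    countable_mdp M \<and> s0 \<in> states M \<and>
    acyclic (transitions M) \<and>
    step_counter_implicit M s0 \<and>
    (\<forall>s\<in>random_states M. \<forall>s'. pmf (probs M s) s' \<in> \<rat>) \<and>
    (\<forall>e\<in>transitions M. reward M e \<in> {-1, 0, 1}) \<and>
    (\<forall>s\<in>states M. finite (successors M s) \<and> card (successors M s) \<le> 2) \<and>
    value_of M s0 (TP_liminf_ge_0 M) = 1 \<and>
    (\<forall>\<sigma>\<in>FR_strategies M. measure (run_measure M s0 \<sigma>) (TP_liminf_ge_0 M) = 0) \<and>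
    (\<forall>\<epsilon><1. \<not> (\<exists>\<sigma>\<in>step_counter_finite_memory_strategies M.
                    eps_optimal M s0 (TP_liminf_ge_0 M) \<epsilon> \<sigma>))"
proof (intro exI[of _ gadgets] exI[of _ initial] conjI ballI allI impI)
  \<comment> \<open>An FR strategy is the case of an update that does not look at the step
    counter.\<close>
  show "measure (run_measure gadgets initial \<sigma>) (TP_liminf_ge_0 gadgets) = 0"
    if "\<sigma> \<in> FR_strategies gadgets" for \<sigma>
    using that by (intro finite_memory_never_wins)
      (auto simp: FR_strategies_def step_counter_finite_memory_strategies_def)
  \<comment> \<open>As the value is 1, an epsilon-optimal strategy would have to win with
    probability at least \<open>1 - \<epsilon> > 0\<close>.\<close>
  show "\<not> (\<exists>\<sigma>\<in>step_counter_finite_memory_strategies gadgets.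
      eps_optimal gadgets initial (TP_liminf_ge_0 gadgets) \<epsilon> \<sigma>)" if "\<epsilon> < 1" for \<epsilon>
    using that finite_memory_never_wins by (auto simp: eps_optimal_def value_gadgets)
qed (simp_all add: countable_mdp_gadgets acyclic_gadgets step_counter_implicit_gadgets
    pmf_probs_rat reward_gadgets[simplified] card_successors value_gadgets)

end
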